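(* Let $f\in L^2(\mathbb{R}^d)$, $f\ne0$, $\alpha>d/2$, and $\bar t,\bar\omega\in\mathbb{R}^d$. Then \[ |\operatorname{supp}f|\,\big\||\omega-\bar\omega|^\alpha\widehat f\big\|_2^{d/\alpha}>\frac{1}{K}\|f\|_2^{d/\alpha} \quad\text{and}\quad |\operatorname{supp}\widehat f|\,\big\||t-\bar t|^\alpha f\big\|_2^{d/\alpha}>\frac{1}{K}\|f\|_2^{d/\alpha}, \] where $K=K(d,\alpha,2)=\frac{\pi^{d/2}}{\alpha}\Gamma(d/2)^{-1}\Gamma\big(\frac{d}{2\alpha}\big)\Gamma\big(1-\frac{d}{2\alpha}\big)\big(\frac{2\alpha}{d}-1\big)^{\frac{d}{2\alpha}}\big(1-\frac{d}{2\alpha}\big)^{-1}$ (with the convention $\infty\cdot c=\infty$ for $c>0$, and the inequalities being trivially true when a left-hand factor is infinite).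
   Context: Fourier transform $\widehat f(\omega)=\int e^{-2\pi i x\cdot\omega}f(x)\,dx$, extended to $L^2$. $|\operatorname{supp} g|$ denotes the Lebesgue measure of the (essential) support $\{g\neq0\}$ of $g$. $\Gamma$ is the Gamma function. *)

theory Defs
  imports "HOL-Analysis.Analysis"
begin

definition L2 :: "('a::euclidean_space \<Rightarrow> complex) \<Rightarrow> bool" where
  "L2 f \<longleftrightarrow> f \<in> borel_measurable lebesgue \<and> integrable lebesgue (\<lambda>x. (cmod (f x))\<^sup>2)"

definition L2_norm :: "('a::euclidean_space \<Rightarrow> complex) \<Rightarrow> real" where
  "L2_norm f = sqrt (LINT x|lebesgue. (cmod (f x))\<^sup>2)"

text \<open>Fourier transform of the truncation of f to the ball of radius R (an L1 function when f is L2).\<close>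
definition fourier_trunc :: "('a::euclidean_space \<Rightarrow> complex) \<Rightarrow> real \<Rightarrow> 'a \<Rightarrow> complex" where
  "fourier_trunc f R \<omega> = (LINT x : ball 0 R | lebesgue. cis (- 2 * pi * (x \<bullet> \<omega>)) * f x)"

text \<open>g is the L2 Fourier transform of f (Plancherel extension):
  g is in L2 and the transforms of the truncations converge to g in L2.\<close>
definition is_fourier_L2 :: "('a::euclidean_space \<Rightarrow> complex) \<Rightarrow> ('a \<Rightarrow> complex) \<Rightarrow> bool" where
  "is_fourier_L2 f g \<longleftrightarrow> L2 g \<and>
     ((\<lambda>R. \<integral>\<^sup>+ \<omega>. ennreal ((cmod (g \<omega> - fourier_trunc f R \<omega>))\<^sup>2) \<partial>lebesgue) \<longlongrightarrow> 0) at_top"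

text \<open>Power of an extended nonnegative real with positive real exponent (\<infinity> ^ p = \<infinity>).\<close>
definition enn_powr :: "ennreal \<Rightarrow> real \<Rightarrow> ennreal" where
  "enn_powr x p = (if x = \<infinity> then \<infinity> else ennreal (enn2real x powr p))"

definition weighted_L2_norm :: "real \<Rightarrow> 'a::euclidean_space \<Rightarrow> ('a \<Rightarrow> complex) \<Rightarrow> ennreal" where
  "weighted_L2_norm a c h =
     enn_powr (\<integral>\<^sup>+ x. ennreal ((norm (x - c) powr a * cmod (h x))\<^sup>2) \<partial>lebesgue) (1/2)"

definition supp_measure :: "('a::euclidean_space \<Rightarrow> complex) \<Rightarrow> ennreal" where
  "supp_measure h = emeasure lebesgue {x. h x \<noteq> 0}"

definition K_const :: "real \<Rightarrow> real \<Rightarrow> real" where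
  "K_const d \<alpha> = pi powr (d/2) / \<alpha> * inverse (Gamma (d/2)) * Gamma (d/(2*\<alpha>))
      * Gamma (1 - d/(2*\<alpha>)) * (2*\<alpha>/d - 1) powr (d/(2*\<alpha>)) * inverse (1 - d/(2*\<alpha>))"

end

theory Submission
  imports Defs "HOL-Probability.Probability"
begin

text \<open>
  If both factors on the left are finite, then \<open>f\<close> and its transform \<open>g\<close> both lie in \<open>L\<^sup>1 \<inter> L\<^sup>2\<close>,
  so each is almost everywhere the (continuous) Fourier integral of the other. With \<open>M = \<parallel>g\<parallel>\<^sub>1\<close> this
  gives \<open>|f| \<le> M\<close>, hence \<open>\<parallel>f\<parallel>\<^sub>2\<^sup>2 \<le> |supp f| M\<^sup>2\<close>; equality would force the continuous function \<open>|f|\<close>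
  to take only the values \<open>0\<close> and \<open>M\<close>, hence to be constant, which is incompatible with a nonzero \<open>f\<close>
  of finite support. Carlson's inequality, i.e. Cauchy--Schwarz against \<open>1 / (1 + l |x - c|\<^sup>2\<^sup>\<alpha>)\<close> with
  optimal \<open>l\<close>, bounds \<open>M\<^sup>2\<close> by \<open>K \<parallel>g\<parallel>\<^sub>2\<^sup>2\<^sup>-\<^sup>d\<^sup>/\<^sup>\<alpha> \<parallel> |x - c|\<^sup>\<alpha> g \<parallel>\<^sub>2\<^sup>d\<^sup>/\<^sup>\<alpha>\<close>, and Plancherel replaces
  \<open>\<parallel>g\<parallel>\<^sub>2\<close> by \<open>\<parallel>f\<parallel>\<^sub>2\<close>. The second inequality is the first with the roles of \<open>f\<close> and \<open>g\<close> exchanged.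
\<close>

section \<open>Fourier integrals of Gaussians\<close>

text \<open>With \<pi> in the exponent, \<open>gauss 1\<close> has mass 1 and is its own Fourier
  transform.\<close>

definition gauss :: "real \<Rightarrow> 'a::euclidean_space \<Rightarrow> real" where
  "gauss a x = exp (- pi * a * (norm x)\<^sup>2)"

text \<open>The Fourier transform is \<open>s = - 2 * pi\<close>, its inverse \<open>s = 2 * pi\<close>.\<close>
definition ft :: "real \<Rightarrow> ('a::euclidean_space \<Rightarrow> complex) \<Rightarrow> 'a \<Rightarrow> complex" where
  "ft s h w = (LINT x|lebesgue. cis (s * (x \<bullet> w)) * h x)"

text \<open>The substitution \<open>y = c * x\<close> with \<open>c = sqrt (2 * pi * a)\<close>
  turns the Gaussian into a multiple of the standard normal density, so the integral is the
  characteristic function of the standard normal distribution at \<open>t / c\<close>.\<close>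

lemma gauss_real_integral:
  fixes t a :: real
  assumes a: "a > 0"
  shows "integrable lborel (\<lambda>x::real. cis (t * x) * of_real (exp (- pi * a * x\<^sup>2)))"
    and "(LINT x|lborel. cis (t * x) * of_real (exp (- pi * a * x\<^sup>2)))
       = of_real (a powr (-1/2) * exp (- t\<^sup>2 / (4 * pi * a)))"
proof -
  define c where "c = sqrt (2 * pi * a)"
  have c: "c > 0" "c\<^sup>2 = 2 * pi * a" using a by (auto simp: c_def)
  let ?F = "\<lambda>y. std_normal_density y *\<^sub>R iexp (t / c * y)"
  have F: "integrable lborel ?F"
    by (rule Bochner_Integration.integrable_bound[OF integrable_normal_density[of 1 0]]) auto
  \<comment> \<open>The argument \<open>0 + c * x\<close> has the shape that the affine substitution
    rules for \<open>lborel\<close> expect.\<close>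
  have eq: "cis (t * x) * of_real (exp (- pi * a * x\<^sup>2)) = sqrt (2*pi) *\<^sub>R ?F (0 + c * x)" for x
  proof -
    have "sqrt (2*pi) * std_normal_density (c * x) = exp (- pi * a * x\<^sup>2)"
      using c by (simp add: std_normal_density_def power_mult_distrib)
    moreover have "iexp (t / c * (c * x)) = cis (t * x)"
      using c by (simp add: cis_conv_exp)
    ultimately show ?thesis 
      by (simp add: scaleR_conv_of_real flip: of_real_mult)
  qed
  show "integrable lborel (\<lambda>x::real. cis (t * x) * of_real (exp (- pi * a * x\<^sup>2)))"
    unfolding eq by (intro integrable_scaleR_right impI lborel_integrable_real_affine F) (use c in auto)
  have "exp (- ((t/c)^2) / 2) = (LINT x|std_normal_distribution. iexp (t / c * x))"
    using fun_cong[OF char_std_normal_distribution, of "t / c"] by (simp add: char_def)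
  also have "\<dots> = integral\<^sup>L lborel ?F"
    by (subst integral_density) auto
  also have "\<dots> = c *\<^sub>R (LINT x|lborel. ?F (0 + c * x))"
    using c by (subst lborel_integral_real_affine[of c _ 0]) auto
  finally have "(LINT x|lborel. ?F (0 + c * x)) = inverse c *\<^sub>R of_real (exp (- ((t/c)^2) / 2))"
    using c by simp
  then have "(LINT x|lborel. cis (t * x) * of_real (exp (- pi * a * x\<^sup>2)))
     = sqrt (2*pi) *\<^sub>R (inverse c *\<^sub>R of_real (exp (- ((t/c)^2) / 2)))"
    unfolding eq by (simp only: integral_scaleR_right)
  also have "\<dots> = (sqrt (2*pi) / c) *\<^sub>R of_real (exp (- ((t/c)^2) / 2))"
    by (simp only: scaleR_scaleR divide_inverse)
  also have "sqrt (2*pi) / c = a powr (-1/2)"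
    using a by (simp add: c_def real_sqrt_mult powr_minus powr_half_sqrt divide_simps)
  also have "- ((t/c)^2) / 2 = - t\<^sup>2 / (4 * pi * a)"
    using c by (simp add: power_divide)
  finally show "(LINT x|lborel. cis (t * x) * of_real (exp (- pi * a * x\<^sup>2)))
       = of_real (a powr (-1/2) * exp (- t\<^sup>2 / (4 * pi * a)))"
    by (simp add: scaleR_conv_of_real)
qed

lemma gauss_measurable [measurable]: "gauss a \<in> borel_measurable borel"
  unfolding gauss_def[abs_def] by measurable

lemma gauss_pos [simp]: "gauss a x > 0" and gauss_nonneg [simp]: "gauss a x \<ge> 0"
  by (auto simp: gauss_def)

text \<open>\<open>lborel\<close> is the image of the product of one-dimensional Lebesgue measures
  under the coordinate map, so integrals of products of functions of single coordinates
  factor.\<close>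

lemma lborel_integral_prod:
  fixes F :: "'a::euclidean_space \<Rightarrow> real \<Rightarrow> complex"
  assumes F: "\<And>b. b \<in> Basis \<Longrightarrow> integrable lborel (F b)"
  shows "integrable lborel (\<lambda>x::'a. \<Prod>b\<in>Basis. F b (x \<bullet> b))"
    and "(LINT x|lborel. (\<Prod>b\<in>Basis. F b ((x::'a) \<bullet> b))) = (\<Prod>b\<in>Basis. (LINT x|lborel. F b x))"
proof -
  interpret product_sigma_finite "\<lambda>_::'a. lborel :: real measure" ..
  have [measurable]: "F b \<in> borel_measurable borel" if "b \<in> Basis" for b
    using borel_measurable_integrable[OF F[OF that]] by simp
  have ip: "((\<Sum>b\<in>Basis. f b *\<^sub>R b) \<bullet> c) = f c" if "c \<in> Basis" for f and c :: 'a
    using that by simp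
  have m: "(\<lambda>x::'a. \<Prod>b\<in>Basis. F b (x \<bullet> b)) \<in> borel_measurable borel"
    by measurable
  show "integrable lborel (\<lambda>x::'a. \<Prod>b\<in>Basis. F b (x \<bullet> b))"
    unfolding lborel_eq[where 'a='a] using m product_integrable_prod[of Basis F] F
    by (subst integrable_distr_eq) (auto simp: ip cong: prod.cong)
  show "(LINT x|lborel. (\<Prod>b\<in>Basis. F b ((x::'a) \<bullet> b))) = (\<Prod>b\<in>Basis. (LINT x|lborel. F b x))"
    unfolding lborel_eq[where 'a='a] using m product_integral_prod[of Basis F] F
    by (subst integral_distr) (auto simp: ip cong: prod.cong)
qed

text \<open>The character and the Gaussian both split into products over the coordinates, which
  reduces everything to dimension one.\<close>

lemma gauss_fourier:
  fixes w :: "'a::euclidean_space"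
  assumes a: "a > 0"
  shows "integrable lebesgue (\<lambda>x::'a. cis (s * (x \<bullet> w)) * of_real (gauss a x))"
    and "ft s (\<lambda>x. of_real (gauss a x)) w
       = of_real (a powr (- real DIM('a) / 2) * exp (- s\<^sup>2 * (norm w)\<^sup>2 / (4 * pi * a)))"
proof -
  let ?F = "\<lambda>b x. cis (s * (w \<bullet> b) * x) * of_real (exp (- pi * a * x\<^sup>2))"
  have nsq: "(norm z)\<^sup>2 = (\<Sum>b\<in>Basis. (z \<bullet> b)\<^sup>2)" for z :: 'a
    by (subst power2_norm_eq_inner, subst euclidean_inner) (simp add: power2_eq_square)
  have csum: "cis (\<Sum>b\<in>B. g b) = (\<Prod>b\<in>B. cis (g b))" for B :: "'a set" and g
    by (induction B rule: infinite_finite_induct) (auto simp flip: cis_mult)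
  have eq: "cis (s * (x \<bullet> w)) * of_real (gauss a x) = (\<Prod>b\<in>Basis. ?F b (x \<bullet> b))" for x :: 'a
  proof -
    have "s * (x \<bullet> w) = (\<Sum>b\<in>Basis. s * (w \<bullet> b) * (x \<bullet> b))"
      by (subst euclidean_inner) (simp add: sum_distrib_left mult_ac)
    moreover have "- pi * a * (norm x)\<^sup>2 = (\<Sum>b\<in>Basis. - pi * a * (x \<bullet> b)\<^sup>2)"
      unfolding nsq sum_distrib_left ..
    ultimately show ?thesis
      unfolding gauss_def by (simp only: csum exp_sum finite_Basis of_real_prod prod.distrib)
  qed
  have I: "integrable lborel (?F b)" for b :: 'a by (rule gauss_real_integral[OF a])
  have m: "(\<lambda>x::'a. cis (s * (x \<bullet> w)) * complex_of_real (gauss a x)) \<in> borel_measurable borel"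
    unfolding cis_conv_exp by measurable
  have "integrable lborel (\<lambda>x::'a. cis (s * (x \<bullet> w)) * of_real (gauss a x))"
    unfolding eq by (rule lborel_integral_prod) (rule I)
  then show "integrable lebesgue (\<lambda>x::'a. cis (s * (x \<bullet> w)) * of_real (gauss a x))"
    using m by (subst integrable_completion) auto
  have "ft s (\<lambda>x. of_real (gauss a x)) w = (LINT x|lborel. cis (s * (x \<bullet> w)) * of_real (gauss a x))"
    unfolding ft_def using m by (subst integral_completion) auto
  also have "\<dots> = (\<Prod>b\<in>Basis. (LINT x|lborel. ?F b x))"
    unfolding eq by (rule lborel_integral_prod) (rule I)
  also have "\<dots> = (\<Prod>b\<in>(Basis::'a set). of_real (a powr (-1/2) * exp (- (s * (w \<bullet> b))\<^sup>2 / (4 * pi * a))))"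
    by (intro prod.cong refl gauss_real_integral(2)[OF a])
  also have "\<dots> = of_real ((a powr (-1/2)) ^ DIM('a) * exp (\<Sum>b\<in>(Basis::'a set). - (s * (w \<bullet> b))\<^sup>2 / (4 * pi * a)))"
    by (simp only: of_real_prod[symmetric] prod.distrib exp_sum finite_Basis prod_constant)
  also have "(\<Sum>b\<in>(Basis::'a set). - (s * (w \<bullet> b))\<^sup>2 / (4 * pi * a)) = - s\<^sup>2 * (norm w)\<^sup>2 / (4 * pi * a)"
    by (simp add: nsq sum_distrib_left sum_divide_distrib power_mult_distrib sum_negf)
  also have "(a powr (-1/2)) ^ DIM('a) = a powr (- real DIM('a) / 2)"
    using a by (simp add: powr_realpow[symmetric] powr_powr)
  finally show "ft s (\<lambda>x. of_real (gauss a x)) w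
       = of_real (a powr (- real DIM('a) / 2) * exp (- s\<^sup>2 * (norm w)\<^sup>2 / (4 * pi * a)))" .
qed

section \<open>Carlson's inequality\<close>

text \<open>Read from right to left, this writes an exponential or a reciprocal as an integral over
  a half-line, in preparation for an exchange of integrals.\<close>

lemma nn_integral_exp_atLeast:
  fixes A u :: real
  assumes A: "A > 0"
  shows "(\<integral>\<^sup>+t. ennreal (exp (- A * t)) * indicator {u..} t \<partial>lborel) = ennreal (exp (- A * u) / A)"
proof -
  have lim: "((\<lambda>t. - exp (- A * t) / A) \<longlongrightarrow> 0) at_top"
    using A by real_asymp
  have "(\<integral>\<^sup>+t. ennreal (exp (- A * t)) * indicator {u..} t \<partial>lborel) = ennreal (0 - (- exp (- A * u) / A))"
    using A by (intro nn_integral_FTC_atLeast lim) (auto intro!: derivative_eq_intros)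
  then show ?thesis by simp
qed

text \<open>Layer-cake argument: \<open>exp (- T)\<close> is the integral of
  \<open>exp (- s)\<close> over \<open>s \<ge> T\<close>. After the exchange of integrals the inner
  integral is the volume of a ball of radius \<open>?R s\<close>, which grows like
  \<open>s powr th\<close>, and a Gamma integral remains.\<close>

lemma nn_integral_exp_norm_powr:
  fixes c :: "'a::euclidean_space"
  assumes p: "p > 0" and t: "t > 0"
  defines "th \<equiv> real DIM('a) / p"
  shows "(\<integral>\<^sup>+x. ennreal (exp (- t * norm (x - c) powr p)) \<partial>lborel)
     = ennreal (unit_ball_vol (real DIM('a)) * Gamma (1 + th) * t powr (- th))"
proof -
  let ?R = "\<lambda>s. (s / t) powr (1 / p)"
  let ?V = "unit_ball_vol (real DIM('a))"
  \<comment> \<open>For negative \<open>s\<close> the sublevel set is empty and \<open>?R s\<close>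
    is not a meaningful radius, hence the extra conjunct.\<close>
  have iff: "t * norm (x - c) powr p \<le> s \<longleftrightarrow> 0 \<le> s \<and> norm (x - c) \<le> ?R s" for x s
  proof (cases "s \<ge> 0")
    case True
    have "t * norm (x - c) powr p \<le> s \<longleftrightarrow> norm (x - c) powr p \<le> s / t"
      using t by (simp add: field_simps)
    also have "\<dots> \<longleftrightarrow> norm (x - c) \<le> ?R s"
    proof
      assume "norm (x - c) powr p \<le> s / t"
      then have "(norm (x - c) powr p) powr (1/p) \<le> ?R s"
        using p by (intro powr_mono2) auto
      then show "norm (x - c) \<le> ?R s" using p by (simp add: powr_powr)
    next
      assume "norm (x - c) \<le> ?R s"
      then have "norm (x - c) powr p \<le> (?R s) powr p"
        using p by (intro powr_mono2) auto
      then show "norm (x - c) powr p \<le> s / t" using p t True by (simp add: powr_powr)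
    qed
    finally show ?thesis using True by simp
  next
    case False
    have "0 \<le> t * norm (x - c) powr p" using t by simp
    then show ?thesis using False by linarith
  qed
  have "(\<integral>\<^sup>+x. ennreal (exp (- t * norm (x - c) powr p)) \<partial>lborel)
    = (\<integral>\<^sup>+x. (\<integral>\<^sup>+s. ennreal (exp (- s)) * indicator {t * norm (x - c) powr p..} s \<partial>lborel) \<partial>lborel)"
    using nn_integral_exp_atLeast[of 1] by simp
  also have "\<dots> = (\<integral>\<^sup>+s. (\<integral>\<^sup>+x. ennreal (exp (- s)) * indicator {t * norm (x - c) powr p..} s \<partial>lborel) \<partial>lborel)"
    by (rule lborel_pair.Fubini') (simp add: indicator_def)
  also have "\<dots> = (\<integral>\<^sup>+s. (\<integral>\<^sup>+x. (ennreal (exp (- s)) * indicator {0..} s) * indicator (cball c (?R s)) x \<partial>lborel) \<partial>lborel)"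
    by (intro nn_integral_cong) (auto simp: indicator_def iff dist_norm norm_minus_commute)
  also have "\<dots> = (\<integral>\<^sup>+s. (ennreal (exp (- s)) * indicator {0..} s) * ennreal (?V * ?R s ^ DIM('a)) \<partial>lborel)"
    by (subst nn_integral_cmult) (auto simp: emeasure_cball intro!: borel_measurable_indicator)
  \<comment> \<open>The exponent stays in the form \<open>1 + th - 1\<close> to match the integral
    for \<open>Gamma (1 + th)\<close>.\<close>
  also have "\<dots> = (\<integral>\<^sup>+s. ennreal (?V * t powr (- th)) * ennreal (indicator {0..} s * s powr (1 + th - 1) / exp s) \<partial>lborel)"
  proof (intro nn_integral_cong)
    fix s :: real
    have "exp (- s) * (?V * ?R s ^ DIM('a)) = ?V * t powr (- th) * (s powr th / exp s)" if "s \<ge> 0"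
    proof -
      have "?R s ^ DIM('a) = s powr th * t powr (- th)"
      proof (cases "s = 0")
        case True then show ?thesis by simp
      next
        case False
        then have "?R s ^ DIM('a) = (s / t) powr th"
          using that t by (simp add: powr_realpow[symmetric] powr_powr th_def)
        then show ?thesis using that t by (simp add: powr_divide powr_minus_divide)
      qed
      then show ?thesis by (simp add: exp_minus field_simps)
    qed
    then show "(ennreal (exp (- s)) * indicator {0..} s) * ennreal (?V * ?R s ^ DIM('a))
      = ennreal (?V * t powr (- th)) * ennreal (indicator {0..} s * s powr (1 + th - 1) / exp s)"
      by (auto simp: indicator_def ennreal_mult[symmetric])
  qed
  also have "\<dots> = ennreal (?V * t powr (- th)) * ennreal (Gamma (1 + th))"
    using p by (subst nn_integral_cmult) (simp_all add: Gamma_conv_nn_integral_real th_def add_pos_nonneg)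
  also have "\<dots> = ennreal (?V * Gamma (1 + th) * t powr (- th))"
    using p by (subst ennreal_mult[symmetric]) (auto simp: ac_simps th_def add_pos_nonneg)
  finally show ?thesis .
qed

text \<open>Write \<open>1 / D\<close> as the integral of \<open>exp (- D * t)\<close> over
  \<open>t \<ge> 0\<close> and exchange. The spatial integral is the previous formula with parameter
  \<open>l * t\<close>; what remains is the integral for \<open>Gamma (1 - th)\<close>, which
  converges because \<open>p\<close> exceeds the dimension.\<close>

lemma nn_integral_inverse_one_plus_norm_powr:
  fixes c :: "'a::euclidean_space"
  assumes p: "p > real DIM('a)" and l: "l > 0"
  defines "th \<equiv> real DIM('a) / p"
  shows "(\<integral>\<^sup>+x. ennreal (1 / (1 + l * norm (x - c) powr p)) \<partial>lborel)
     = ennreal (unit_ball_vol (real DIM('a)) * Gamma (1 + th) * Gamma (1 - th) * l powr (- th))"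
proof -
  let ?C = "unit_ball_vol (real DIM('a)) * Gamma (1 + th)"
  have p0: "p > 0" using p by (meson le_less_trans of_nat_0_le_iff)
  have th: "0 < th" "th < 1" using p p0 by (auto simp: th_def)
  have pos: "1 + l * norm (x - c) powr p > 0" for x
    using l by (simp add: add_pos_nonneg)
  have "(\<integral>\<^sup>+x. ennreal (1 / (1 + l * norm (x - c) powr p)) \<partial>lborel)
    = (\<integral>\<^sup>+x. (\<integral>\<^sup>+t. ennreal (exp (- (1 + l * norm (x - c) powr p) * t)) * indicator {0..} t \<partial>lborel) \<partial>lborel)"
    by (intro nn_integral_cong) (simp only: nn_integral_exp_atLeast[OF pos], simp)
  also have "\<dots> = (\<integral>\<^sup>+t. (\<integral>\<^sup>+x. ennreal (exp (- (1 + l * norm (x - c) powr p) * t)) * indicator {0..} t \<partial>lborel) \<partial>lborel)"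
    by (rule lborel_pair.Fubini') (simp add: indicator_def)
  also have "\<dots> = (\<integral>\<^sup>+t. (\<integral>\<^sup>+x. ennreal (exp (- t)) * indicator {0..} t * ennreal (exp (- (l * t) * norm (x - c) powr p)) \<partial>lborel) \<partial>lborel)"
    by (intro nn_integral_cong) (auto simp: indicator_def ennreal_mult[symmetric] mult_exp_exp algebra_simps)
  also have "\<dots> = (\<integral>\<^sup>+t. ennreal (exp (- t)) * indicator {0..} t * (\<integral>\<^sup>+x. ennreal (exp (- (l * t) * norm (x - c) powr p)) \<partial>lborel) \<partial>lborel)"
    by (intro nn_integral_cong nn_integral_cmult) measurable
  also have "\<dots> = (\<integral>\<^sup>+t. ennreal (?C * l powr (- th)) * ennreal (indicator {0..} t * t powr ((1 - th) - 1) / exp t) \<partial>lborel)"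
  proof (rule nn_integral_cong_AE)
    have C: "?C \<ge> 0" using th by (simp add: add_pos_pos)
    \<comment> \<open>The spatial formula requires a positive parameter, so the null set
      \<open>t = 0\<close> is set aside.\<close>
    have "AE t in lborel. t \<noteq> (0::real)" by (rule AE_lborel_singleton)
    then show "AE t in lborel. ennreal (exp (- t)) * indicator {0..} t * (\<integral>\<^sup>+x. ennreal (exp (- (l * t) * norm (x - c) powr p)) \<partial>lborel)
       = ennreal (?C * l powr (- th)) * ennreal (indicator {0..} t * t powr ((1 - th) - 1) / exp t)"
    proof eventually_elim
      fix t :: real assume "t \<noteq> 0"
      show "ennreal (exp (- t)) * indicator {0..} t * (\<integral>\<^sup>+x. ennreal (exp (- (l * t) * norm (x - c) powr p)) \<partial>lborel)
       = ennreal (?C * l powr (- th)) * ennreal (indicator {0..} t * t powr ((1 - th) - 1) / exp t)"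
      proof (cases "t > 0")
        case True
        have "exp (- t) * (?C * (l * t) powr (- th)) = (?C * l powr (- th)) * (t powr ((1 - th) - 1) / exp t)"
          using True l by (simp add: powr_mult exp_minus field_simps)
        moreover have "(\<integral>\<^sup>+x. ennreal (exp (- (l * t) * norm (x - c) powr p)) \<partial>lborel) = ennreal (?C * (l * t) powr (- th))"
          unfolding th_def by (rule nn_integral_exp_norm_powr) (use p0 l True in auto)
        ultimately show ?thesis using True C by (simp add: ennreal_mult[symmetric] del: mult_minus_left)
      qed (use \<open>t \<noteq> 0\<close> in auto)
    qed
  qed
  also have "\<dots> = ennreal (?C * l powr (- th)) * ennreal (Gamma (1 - th))"
    using th by (subst nn_integral_cmult) (simp_all add: Gamma_conv_nn_integral_real)
  also have "\<dots> = ennreal (?C * Gamma (1 - th) * l powr (- th))"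
    using th by (subst ennreal_mult[symmetric]) (auto simp: ac_simps)
  finally show ?thesis .
qed

text \<open>This is the form in which the constant arises from integrating the Carlson weight. The
  recurrence \<open>Gamma (z + 1) = z * Gamma z\<close>, used at \<open>th\<close> and at
  \<open>d / 2\<close>, absorbs the factor \<open>1 / \<alpha>\<close>.\<close>

lemma K_const_eq:
  fixes d \<alpha> :: real
  assumes d: "d > 0" and \<alpha>: "\<alpha> > d / 2"
  defines "th \<equiv> d / (2 * \<alpha>)"
  shows "K_const d \<alpha> = unit_ball_vol d * Gamma (1 + th) * Gamma (1 - th)
      * ((1 - th) / th) powr th / (1 - th)"
proof -
  have th: "0 < th" "th < 1" and a0: "\<alpha> > 0" using d \<alpha> by (auto simp: th_def)
  have g1: "Gamma (1 + th) = th * Gamma th"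
    using th Gamma_plus1[of th] nonpos_Ints_nonpos[of th] by (auto simp: add.commute)
  have g2: "Gamma (d/2 + 1) = d/2 * Gamma (d/2)"
    using d Gamma_plus1[of "d/2"] nonpos_Ints_nonpos[of "d/2"] by auto
  have r: "(1 - th) / th = 2*\<alpha>/d - 1" using d a0 by (simp add: th_def field_simps)
  have gp: "Gamma (d/2) > 0" using d by (intro Gamma_real_pos) auto
  have "pi powr (d/2) / \<alpha> * inverse (Gamma (d/2)) * Gamma th
      = unit_ball_vol d * Gamma (1 + th)"
  proof -
    have "q / \<alpha> * inverse g * h = q / (d / 2 * g) * (th * h)" if "g > 0" for q g h :: real
      using that d a0 by (simp add: th_def field_simps)
    from this[OF gp] show ?thesis unfolding unit_ball_vol_def g1 g2 .
  qed
  then show ?thesis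
    unfolding K_const_def th_def[symmetric] r by (simp only: divide_inverse[symmetric])
qed

lemma K_const_pos:
  fixes d \<alpha> :: real
  assumes d: "d > 0" and \<alpha>: "\<alpha> > d / 2"
  shows "K_const d \<alpha> > 0"
proof -
  have th: "0 < d / (2 * \<alpha>)" "d / (2 * \<alpha>) < 1" using d \<alpha> by auto
  then show ?thesis unfolding K_const_eq[OF assms] using d
    by (auto intro!: divide_pos_pos mult_pos_pos Gamma_real_pos simp: add_pos_pos simp del: times_divide_eq_right)
qed

text \<open>The weight parameter \<open>l\<close> in the proof minimises \<open>(A + l * B) * l powr (- th)\<close>.\<close>
lemma carlson_nn_integral:
  fixes v :: "'a::euclidean_space \<Rightarrow> complex" and c :: 'a
  assumes v [measurable]: "v \<in> borel_measurable lebesgue"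
    and \<alpha>: "\<alpha> > real DIM('a) / 2"
    and A: "(\<integral>\<^sup>+x. ennreal ((cmod (v x))\<^sup>2) \<partial>lebesgue) = ennreal A" "A > 0"
    and B: "(\<integral>\<^sup>+x. ennreal ((norm (x - c) powr \<alpha> * cmod (v x))\<^sup>2) \<partial>lebesgue) = ennreal B" "B > 0"
  defines "th \<equiv> real DIM('a) / (2 * \<alpha>)"
  shows "(\<integral>\<^sup>+x. ennreal (cmod (v x)) \<partial>lebesgue)\<^sup>2
     \<le> ennreal (K_const (real DIM('a)) \<alpha> * A powr (1 - th) * B powr th)"
proof -
  let ?d = "real DIM('a)"
  have a0: "\<alpha> > 0" using \<alpha> by (smt (verit) divide_nonneg_pos of_nat_0_le_iff)
  have th: "0 < th" "th < 1" using \<alpha> a0 by (auto simp: th_def)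
  define l where "l = th / (1 - th) * (A / B)"
  have l: "l > 0" using th A B by (simp add: l_def)
  define D where "D = (\<lambda>x::'a. 1 + l * norm (x - c) powr (2 * \<alpha>))"
  have D: "D x > 0" for x using l by (simp add: D_def add_pos_nonneg)
  have Db [measurable]: "D \<in> borel_measurable borel" unfolding D_def by measurable
  have [measurable]: "D \<in> borel_measurable lebesgue" using Db by (intro measurable_completion) auto
  have Nm [measurable]: "(\<lambda>x. norm (x - c)) \<in> borel_measurable lebesgue" by (intro measurable_completion) auto
  \<comment> \<open>The factor \<open>sqrt (D x)\<close> is moved onto \<open>v\<close> so that
    Cauchy-Schwarz separates the weighted norms of \<open>v\<close> from the explicit integral of
    \<open>1 / D\<close>.\<close>
  have "(\<integral>\<^sup>+x. ennreal (cmod (v x)) \<partial>lebesgue) = 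
    (\<integral>\<^sup>+x. ennreal (sqrt (D x) * cmod (v x)) * ennreal (1 / sqrt (D x)) \<partial>lebesgue)"
    using D by (intro nn_integral_cong) (simp add: ennreal_mult[symmetric] less_imp_le less_imp_neq[symmetric])
  then have "(\<integral>\<^sup>+x. ennreal (cmod (v x)) \<partial>lebesgue)\<^sup>2 
    \<le> (\<integral>\<^sup>+x. (ennreal (sqrt (D x) * cmod (v x)))\<^sup>2 \<partial>lebesgue) * (\<integral>\<^sup>+x. (ennreal (1 / sqrt (D x)))\<^sup>2 \<partial>lebesgue)"
    by (simp only:, intro Cauchy_Schwarz_nn_integral) measurable
  also have "(\<integral>\<^sup>+x. (ennreal (1 / sqrt (D x)))\<^sup>2 \<partial>lebesgue) = (\<integral>\<^sup>+x. ennreal (1 / D x) \<partial>lborel)"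
    using D by (subst nn_integral_completion) (intro nn_integral_cong, simp add: ennreal_power power_divide less_imp_le)
  also have "\<dots> = ennreal (unit_ball_vol ?d * Gamma (1 + th) * Gamma (1 - th) * l powr (- th))"
    using nn_integral_inverse_one_plus_norm_powr[of "2*\<alpha>" l c] l \<alpha> by (simp add: th_def D_def)
  also have "(\<integral>\<^sup>+x. (ennreal (sqrt (D x) * cmod (v x)))\<^sup>2 \<partial>lebesgue)
     = (\<integral>\<^sup>+x. ennreal ((cmod (v x))\<^sup>2) + ennreal l * ennreal ((norm (x - c) powr \<alpha> * cmod (v x))\<^sup>2) \<partial>lebesgue)"
  proof (intro nn_integral_cong)
    fix x :: 'a
    have "norm (x - c) powr (2 * \<alpha>) = (norm (x - c) powr \<alpha>)\<^sup>2"
      by (simp add: power2_eq_square powr_add[symmetric])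
    then have "(sqrt (D x) * cmod (v x))\<^sup>2 = (cmod (v x))\<^sup>2 + l * (norm (x - c) powr \<alpha> * cmod (v x))\<^sup>2"
      using D[of x] by (simp add: power_mult_distrib) (simp add: D_def algebra_simps)
    then show "(ennreal (sqrt (D x) * cmod (v x)))\<^sup>2 = ennreal ((cmod (v x))\<^sup>2) + ennreal l * ennreal ((norm (x - c) powr \<alpha> * cmod (v x))\<^sup>2)"
      using D[of x] l by (simp add: ennreal_power ennreal_mult[symmetric] less_imp_le del: power_mult_distrib flip: ennreal_plus)
  qed
  also have "\<dots> = ennreal A + ennreal l * ennreal B"
    by (subst nn_integral_add) (auto simp: nn_integral_cmult A B)
  also have "\<dots> = ennreal (A + l * B)" using A B l by (simp add: ennreal_mult[symmetric] flip: ennreal_plus)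
  \<comment> \<open>The choice of \<open>l\<close> makes \<open>l * B\<close> equal to
    \<open>th / (1 - th) * A\<close>.\<close>
  also have "A + l * B = A / (1 - th)" using B th by (simp add: l_def field_simps)
  also have "ennreal (A / (1 - th)) * ennreal (unit_ball_vol ?d * Gamma (1 + th) * Gamma (1 - th) * l powr (- th))
    = ennreal (A / (1 - th) * (unit_ball_vol ?d * Gamma (1 + th) * Gamma (1 - th) * l powr (- th)))"
    using A th by (intro ennreal_mult[symmetric]) auto
  also have "A / (1 - th) * (unit_ball_vol ?d * Gamma (1 + th) * Gamma (1 - th) * l powr (- th))
     = K_const ?d \<alpha> * A powr (1 - th) * B powr th"
  proof -
    have "l powr (- th) = inverse l powr th"
      using l by (simp only: powr_minus inverse_powr less_imp_le)
    also have "inverse l = (1 - th) / th * (B / A)"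
      using th A B by (simp add: l_def)
    also have "\<dots> powr th = ((1 - th) / th) powr th * (B powr th / A powr th)"
      using th A B by (simp only: powr_mult powr_divide divide_nonneg_nonneg less_imp_le diff_ge_0_iff_ge)
    finally have l': "l powr (- th) = ((1 - th) / th) powr th * (B powr th / A powr th)" .
    have "A powr (1 - th) = A / A powr th" using A by (simp add: powr_diff)
    with l' have "A * l powr (- th) = ((1 - th) / th) powr th * B powr th * A powr (1 - th)"
      by simp
    moreover have "K_const ?d \<alpha> = unit_ball_vol ?d * Gamma (1 + th) * Gamma (1 - th) * ((1 - th) / th) powr th / (1 - th)"
      unfolding th_def using \<alpha> by (intro K_const_eq) auto
    ultimately show ?thesis by (simp add: mult_ac)
  qed
  finally show ?thesis .
qed

section \<open>Fourier integrals of integrable functions\<close>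

lemma sigma_finite_lebesgue: "sigma_finite_measure (lebesgue :: 'a::euclidean_space measure)"
proof
  let ?A = "range (\<lambda>n::nat. ball (0::'a) (real n))"
  have "\<Union>?A = UNIV"
    using reals_Archimedean2 by (auto simp: dist_norm)
  moreover have "emeasure lebesgue (ball (0::'a) r) \<noteq> \<infinity>" for r
    using emeasure_lborel_ball_finite[of "0::'a" r] by (simp add: less_top)
  ultimately show "\<exists>A. countable A \<and> A \<subseteq> sets (lebesgue :: 'a measure) \<and> \<Union>A = space lebesgue \<and> (\<forall>a\<in>A. emeasure lebesgue a \<noteq> \<infinity>)"
    by (intro exI[of _ ?A]) auto
qed

interpretation lebesgue: sigma_finite_measure "lebesgue :: 'a::euclidean_space measure"
  by (rule sigma_finite_lebesgue)

interpretation lebesgue_pair: pair_sigma_finite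
  "lebesgue :: 'a::euclidean_space measure" "lebesgue :: 'b::euclidean_space measure" ..

lemma borel_measurable_lebesgueI: "f \<in> borel_measurable borel \<Longrightarrow> f \<in> borel_measurable lebesgue"
  by (intro measurable_completion) simp

lemma measurable_id_lebesgue_borel: "(\<lambda>x. x) \<in> lebesgue \<rightarrow>\<^sub>M borel"
  by (intro measurable_completion) simp

text \<open>The kernels below are Borel in both variables jointly, while Fubini is applied to the
  product of two completed measures; the identity map carries measurability over in each
  factor.\<close>

lemma borel_measurable_lebesgue_pairI:
  assumes "f \<in> borel_measurable (borel \<Otimes>\<^sub>M borel)"
  shows "f \<in> borel_measurable (lebesgue \<Otimes>\<^sub>M lebesgue)"
proof -
  have "(\<lambda>p. (fst p, snd p)) \<in> lebesgue \<Otimes>\<^sub>M lebesgue \<rightarrow>\<^sub>M borel \<Otimes>\<^sub>M borel"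
    by (intro measurable_Pair measurable_compose[OF measurable_fst measurable_id_lebesgue_borel]
          measurable_compose[OF measurable_snd measurable_id_lebesgue_borel])
  from measurable_compose[OF this assms] show ?thesis by simp
qed

lemma cis_measurable [measurable]: "cis \<in> borel_measurable borel"
  by (intro borel_measurable_continuous_onI continuous_intros)

lemma cnj_measurable [measurable]: "cnj \<in> borel_measurable borel"
  by (intro borel_measurable_continuous_onI continuous_intros)

lemma cis_inner_measurable:
  "(\<lambda>x::'a::euclidean_space. cis (s * (x \<bullet> w))) \<in> borel_measurable lebesgue"
  by (rule borel_measurable_lebesgueI) measurable

text \<open>Supplies the product majorants that justify the later exchanges of integrals.\<close>

lemma integrable_lebesgue_pair_mult:
  fixes h :: "'a::euclidean_space \<Rightarrow> complex" and k :: "'b::euclidean_space \<Rightarrow> complex"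
  assumes h: "integrable lebesgue h" and k: "integrable lebesgue k"
  shows "integrable (lebesgue \<Otimes>\<^sub>M lebesgue) (\<lambda>p. h (fst p) * k (snd p))"
proof -
  have [measurable]: "h \<in> borel_measurable lebesgue" "k \<in> borel_measurable lebesgue"
    using h k by auto
  have "integrable (lebesgue \<Otimes>\<^sub>M lebesgue) (\<lambda>(x, y). h x * k y)"
  proof (rule lebesgue_pair.Fubini_integrable)
    show "integrable lebesgue (\<lambda>x. LINT y|lebesgue. norm (case (x, y) of (x, y) \<Rightarrow> h x * k y))"
      using h by (simp add: norm_mult)
    show "AE x in lebesgue. integrable lebesgue (\<lambda>y. case (x, y) of (x, y) \<Rightarrow> h x * k y)"
      using k by simp
  qed measurable
  then show ?thesis by (simp add: case_prod_beta')
qed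

section \<open>Elementary properties of the Fourier integral\<close>

lemma ft_integrable:
  assumes "integrable lebesgue h"
  shows "integrable lebesgue (\<lambda>x. cis (s * (x \<bullet> w)) * h x)"
  by (rule Bochner_Integration.integrable_bound[OF assms])
     (use assms in \<open>auto simp: norm_mult intro!: borel_measurable_times cis_inner_measurable\<close>)

lemma ft_bound:
  assumes "integrable lebesgue h"
  shows "cmod (ft s h w) \<le> (LINT x|lebesgue. cmod (h x))"
proof -
  have "cmod (ft s h w) \<le> (LINT x|lebesgue. cmod (cis (s * (x \<bullet> w)) * h x))"
    unfolding ft_def by (rule integral_norm_bound)
  then show ?thesis by (simp add: norm_mult)
qed

text \<open>Dominated convergence with majorant \<open>cmod (h x)\<close>. Continuity is what later
  turns an almost-everywhere statement about the modulus into one that holds everywhere.\<close>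

lemma ft_continuous:
  fixes h :: "'a::euclidean_space \<Rightarrow> complex"
  assumes h: "integrable lebesgue h"
  shows "continuous_on UNIV (ft s h)"
proof -
  have "(\<lambda>n. ft s h (X n)) \<longlonglongrightarrow> ft s h w" if "X \<longlonglongrightarrow> w" for X and w :: 'a
    unfolding ft_def
  proof (rule integral_dominated_convergence)
    show "integrable lebesgue (\<lambda>x. cmod (h x))" using h by simp
    show "AE x in lebesgue. (\<lambda>n. cis (s * (x \<bullet> X n)) * h x) \<longlonglongrightarrow> cis (s * (x \<bullet> w)) * h x"
      using that by (intro AE_I2 tendsto_intros)
  qed (use h in \<open>auto simp: norm_mult intro!: borel_measurable_times cis_inner_measurable\<close>)
  then show ?thesis
    by (auto simp: continuous_on_sequentially comp_def)
qed

lemma ft_measurable: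
  assumes h: "integrable lebesgue h"
  shows "ft s h \<in> borel_measurable borel" "ft s h \<in> borel_measurable lebesgue"
  using borel_measurable_continuous_onI[OF ft_continuous[OF h]]
  by (auto intro: borel_measurable_lebesgueI)

text \<open>The kernel \<open>cis (s * (x \<bullet> w))\<close> is symmetric in \<open>x\<close> and
  \<open>w\<close>, so Fubini moves the transform from one factor to the other.\<close>

lemma ft_multiplication_formula:
  fixes h k :: "'a::euclidean_space \<Rightarrow> complex"
  assumes h: "integrable lebesgue h" and k: "integrable lebesgue k"
  shows "(LINT w|lebesgue. k w * ft s h w) = (LINT x|lebesgue. h x * ft s k x)"
proof -
  have [measurable]: "h \<in> borel_measurable lebesgue" "k \<in> borel_measurable lebesgue"
    using h k by auto
  have [measurable]: "(\<lambda>p::'a \<times> 'a. cis (s * (snd p \<bullet> fst p))) \<in> borel_measurable (lebesgue \<Otimes>\<^sub>M lebesgue)"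
    by (rule borel_measurable_lebesgue_pairI) measurable
  have I: "integrable (lebesgue \<Otimes>\<^sub>M lebesgue) (\<lambda>(w, x). cis (s * (x \<bullet> w)) * (k w * h x))"
    using integrable_lebesgue_pair_mult[OF k h]
    by (rule Bochner_Integration.integrable_bound) (auto simp: norm_mult case_prod_beta')
  have "(LINT w|lebesgue. k w * ft s h w) = (LINT w|lebesgue. LINT x|lebesgue. cis (s * (x \<bullet> w)) * (k w * h x))"
    unfolding ft_def by (simp add: mult_ac flip: integral_mult_right_zero)
  also have "\<dots> = (LINT x|lebesgue. LINT w|lebesgue. cis (s * (x \<bullet> w)) * (k w * h x))"
    by (rule lebesgue_pair.Fubini_integral[OF I, symmetric])
  also have "\<dots> = (LINT x|lebesgue. h x * ft s k x)"
    unfolding ft_def by (simp add: mult_ac inner_commute flip: integral_mult_right_zero)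
  finally show ?thesis .
qed

section \<open>Gaussian kernels and their pairings with Fourier integrals\<close>

lemma gauss_integrable:
  fixes y :: "'a::euclidean_space"
  assumes a: "a > 0"
  shows "integrable lebesgue (\<lambda>x. gauss a (x - y))"
proof -
  have "integrable lebesgue (\<lambda>x::'a. complex_of_real (gauss a x))"
    using gauss_fourier(1)[OF a, of 0 0] by simp
  then have "integrable lborel (\<lambda>x::'a. gauss a x)"
    by (subst (asm) complex_of_real_integrable_eq) (simp add: integrable_completion)
  then have "integrable (distr lborel borel ((+) (-y))) (\<lambda>x::'a. gauss a x)"
    by (simp add: lborel_distr_plus)
  then have "integrable lborel (\<lambda>x. gauss a (x - y))"
    by (subst (asm) integrable_distr_eq) auto
  then show ?thesis by (subst integrable_completion) auto
qed

lemma gauss_measurable_lebesgue [measurable]: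
  "(\<lambda>x. gauss a (x - y)) \<in> borel_measurable lebesgue" "gauss a \<in> borel_measurable lebesgue"
  by (auto intro!: borel_measurable_lebesgueI)

lemma gauss_minus_commute: "gauss a (x - y) = gauss a (y - x)"
  by (simp add: gauss_def norm_minus_commute)

text \<open>The condition on \<open>s\<close> covers both the transform and its inverse.\<close>

lemma ft_gauss:
  fixes w :: "'a::euclidean_space"
  assumes a: "a > 0" and s: "s\<^sup>2 = 4 * pi\<^sup>2"
  shows "ft s (\<lambda>x. of_real (gauss a x)) w = of_real (a powr (- real DIM('a) / 2) * gauss (1 / a) w)"
  unfolding gauss_fourier(2)[OF a] s by (simp add: gauss_def power2_eq_square)

text \<open>Borel measurability of \<open>h\<close> allows the passage to \<open>lborel\<close>,
  where translation invariance is applied.\<close>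

lemma ft_translate:
  fixes h :: "'a::euclidean_space \<Rightarrow> complex"
  assumes h[measurable]: "h \<in> borel_measurable borel"
  shows "ft s (\<lambda>x. h (x - y)) w = cis (s * (y \<bullet> w)) * ft s h w"
proof -
  have "ft s (\<lambda>x. h (x - y)) w = (LINT x|lborel. cis (s * (x \<bullet> w)) * h (x - y))"
    unfolding ft_def by (rule integral_completion) measurable
  also have "\<dots> = (LINT x|distr lborel borel ((+) y). cis (s * (x \<bullet> w)) * h (x - y))"
    by (simp add: lborel_distr_plus)
  also have "\<dots> = (LINT x|lborel. cis (s * (y \<bullet> w)) * (cis (s * (x \<bullet> w)) * h x))"
    by (subst integral_distr) (auto simp: inner_add_left cis_mult distrib_left mult.assoc[symmetric])
  also have "\<dots> = cis (s * (y \<bullet> w)) * (LINT x|lborel. cis (s * (x \<bullet> w)) * h x)"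
    by (rule integral_mult_right_zero)
  also have "(LINT x|lborel. cis (s * (x \<bullet> w)) * h x) = ft s h w"
    unfolding ft_def by (rule integral_completion[symmetric]) measurable
  finally show ?thesis .
qed

text \<open>The integral is the transform at frequency \<open>0\<close>.\<close>

lemma integral_gauss:
  fixes y :: "'a::euclidean_space"
  assumes a: "a > 0"
  shows "(LINT x|lebesgue. gauss a (x - y)) = a powr (- real DIM('a) / 2)"
proof -
  have "complex_of_real (LINT x|lebesgue. gauss a (x - y)) = ft (2 * pi) (\<lambda>x. of_real (gauss a (x - y))) 0"
    by (simp add: ft_def)
  also have "\<dots> = of_real (a powr (- real DIM('a) / 2))"
    using a by (subst ft_translate[of "\<lambda>x. of_real (gauss a x)"], measurable)
       (subst ft_gauss, simp_all add: gauss_def)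
  finally show ?thesis using of_real_eq_iff by blast
qed

text \<open>The multiplication formula with a modulated Gaussian, whose transform is a translated
  one. It equates a Gaussian-damped inversion integral of \<open>ft s h\<close> with
  \<open>h\<close> smoothed by a Gaussian of mass 1.\<close>

lemma ft_gauss_pairing:
  fixes h :: "'a::euclidean_space \<Rightarrow> complex"
  assumes h: "integrable lebesgue h" and a: "a > 0" and s: "s\<^sup>2 = 4 * pi\<^sup>2"
  shows "(LINT w|lebesgue. of_real (gauss a w) * cis (- s * (w \<bullet> x)) * ft s h w)
     = of_real (a powr (- real DIM('a) / 2)) * (LINT y|lebesgue. h y * of_real (gauss (1 / a) (y - x)))"
proof -
  let ?k = "\<lambda>w. cis (- s * (w \<bullet> x)) * of_real (gauss a w)"
  have k: "integrable lebesgue ?k" by (rule gauss_fourier(1)[OF a])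
  have "ft s ?k y = ft s (\<lambda>w. of_real (gauss a w)) (y - x)" for y
    unfolding ft_def by (simp add: inner_diff_right cis_mult right_diff_distrib flip: mult.assoc)
  then have fk: "ft s ?k y = of_real (a powr (- real DIM('a) / 2)) * of_real (gauss (1 / a) (y - x))" for y
    using ft_gauss[OF a s] by simp
  have "(LINT w|lebesgue. of_real (gauss a w) * cis (- s * (w \<bullet> x)) * ft s h w) = (LINT w|lebesgue. ?k w * ft s h w)"
    by (simp add: mult.commute)
  also have "\<dots> = (LINT y|lebesgue. h y * ft s ?k y)"
    by (rule ft_multiplication_formula[OF h k])
  also have "\<dots> = of_real (a powr (- real DIM('a) / 2)) * (LINT y|lebesgue. h y * of_real (gauss (1 / a) (y - x)))"
    unfolding fk by (subst integral_mult_right_zero[symmetric]) (simp add: mult_ac)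
  finally show ?thesis .
qed

text \<open>The dual computation: a translated Gaussian has a modulated transform, so smoothing
  \<open>ft s h\<close> amounts to damping \<open>h\<close>.\<close>

lemma ft_gauss_convolution:
  fixes h :: "'a::euclidean_space \<Rightarrow> complex"
  assumes h: "integrable lebesgue h" and a: "a > 0" and s: "s\<^sup>2 = 4 * pi\<^sup>2"
  shows "(LINT y|lebesgue. ft s h y * of_real (gauss a (y - x)))
     = of_real (a powr (- real DIM('a) / 2)) * (LINT w|lebesgue. of_real (gauss (1 / a) w) * cis (s * (w \<bullet> x)) * h w)"
proof -
  let ?k = "\<lambda>y. complex_of_real (gauss a (y - x))"
  have k: "integrable lebesgue ?k" by (intro integrable_of_real gauss_integrable a)
  have fk: "ft s ?k w = cis (s * (x \<bullet> w)) * of_real (a powr (- real DIM('a) / 2) * gauss (1 / a) w)" for w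
    by (subst ft_translate[of "\<lambda>x. of_real (gauss a x)"]) (simp_all add: ft_gauss[OF a s])
  have "(LINT y|lebesgue. ft s h y * of_real (gauss a (y - x))) = (LINT y|lebesgue. ?k y * ft s h y)"
    by (simp add: mult.commute)
  also have "\<dots> = (LINT w|lebesgue. h w * ft s ?k w)"
    by (rule ft_multiplication_formula[OF h k])
  also have "\<dots> = of_real (a powr (- real DIM('a) / 2)) * (LINT w|lebesgue. of_real (gauss (1 / a) w) * cis (s * (w \<bullet> x)) * h w)"
    unfolding fk by (subst integral_mult_right_zero[symmetric]) (simp add: mult_ac inner_commute)
  finally show ?thesis .
qed

lemma nn_integral_gauss:
  fixes y :: "'a::euclidean_space"
  assumes a: "a > 0"
  shows "(\<integral>\<^sup>+x. ennreal (gauss a (x - y)) \<partial>lebesgue) = ennreal (a powr (- real DIM('a) / 2))"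
  using nn_integral_eq_integral[OF gauss_integrable[OF a, of y]] integral_gauss[OF a, of y] by simp

lemma gauss_tendsto_1: "(\<lambda>n. gauss (1 / real (Suc n)) x) \<longlonglongrightarrow> 1"
proof -
  have "(\<lambda>n. - pi * (1 / real (Suc n)) * (norm x)\<^sup>2) \<longlonglongrightarrow> - pi * 0 * (norm x)\<^sup>2"
    by (intro tendsto_intros LIMSEQ_Suc[OF lim_1_over_n])
  from tendsto_exp[OF this] show ?thesis by (simp add: gauss_def)
qed

text \<open>
  The left side is the quadratic form of convolution with a Gaussian of mass 1, so the Schur test
  applies.
\<close>
lemma ft_gauss_L2_le:
  fixes h :: "'a::euclidean_space \<Rightarrow> complex"
  assumes h: "integrable lebesgue h" and a: "a > 0" and s: "s\<^sup>2 = 4 * pi\<^sup>2"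
  shows "(\<integral>\<^sup>+w. ennreal (gauss a w * (cmod (ft s h w))\<^sup>2) \<partial>lebesgue) \<le> (\<integral>\<^sup>+x. ennreal ((cmod (h x))\<^sup>2) \<partial>lebesgue)"
proof -
  let ?c = "a powr (- real DIM('a) / 2)"
  let ?G = "\<lambda>x y. ?c * gauss (1 / a) (y - x)"
  \<comment> \<open>Paired with \<open>ft s h\<close>, this gives the damped squared modulus on the
    left; its own transform is the conjugate of \<open>h\<close> convolved with the unit-mass kernel
    \<open>?G\<close>.\<close>
  let ?k = "\<lambda>w. of_real (gauss a w) * cnj (ft s h w)"
  let ?N = "\<integral>\<^sup>+x. ennreal ((cmod (h x))\<^sup>2) \<partial>lebesgue"
  have [measurable]: "h \<in> borel_measurable lebesgue" using h by auto
  note ft_measurable(2)[OF h, measurable]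
  have [measurable]: "(\<lambda>w. cnj (ft s h w)) \<in> borel_measurable lebesgue"
    by (rule measurable_compose[OF ft_measurable(2)[OF h] cnj_measurable])
  have [measurable]: "(\<lambda>w::'a. complex_of_real (gauss a w)) \<in> borel_measurable lebesgue"
    by (rule borel_measurable_lebesgueI) measurable
  have [measurable]: "(\<lambda>p::'a \<times> 'a. gauss (1/a) (snd p - fst p)) \<in> borel_measurable (lebesgue \<Otimes>\<^sub>M lebesgue)"
    by (rule borel_measurable_lebesgue_pairI) measurable
  have mG: "(\<lambda>(y, x). ennreal ((cmod (h y))\<^sup>2 / 2) * ennreal (?G x y)) \<in> borel_measurable (lebesgue \<Otimes>\<^sub>M lebesgue)"
  proof -
    have [measurable]: "(\<lambda>p::'a \<times> 'a. gauss (1/a) (fst p - snd p)) \<in> borel_measurable (lebesgue \<Otimes>\<^sub>M lebesgue)"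
      by (rule borel_measurable_lebesgue_pairI) measurable
    show ?thesis unfolding case_prod_beta' by measurable
  qed
  have gi: "integrable lebesgue (\<lambda>w::'a. gauss a w)" using gauss_integrable[OF a, of 0] by simp
  \<comment> \<open>The uniform bound \<open>M\<close> makes \<open>?k\<close> and the damped square
    integrable.\<close>
  define M where "M = (LINT x|lebesgue. cmod (h x))"
  have M: "cmod (ft s h w) \<le> M" for w using ft_bound[OF h] by (simp add: M_def)
  have M0: "M \<ge> 0" by (simp add: M_def)
  have k: "integrable lebesgue ?k"
  proof (rule Bochner_Integration.integrable_bound)
    show "integrable lebesgue (\<lambda>w::'a. gauss a w * M)" using gi by simp
    show "AE x in lebesgue. norm (?k x) \<le> norm (gauss a x * M)"
      using M M0 by (intro AE_I2) (simp add: norm_mult mult_left_mono)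
  qed measurable
  have I: "integrable lebesgue (\<lambda>w. gauss a w * (cmod (ft s h w))\<^sup>2)"
  proof (rule Bochner_Integration.integrable_bound)
    show "integrable lebesgue (\<lambda>w::'a. gauss a w * M\<^sup>2)" using gi by simp
    show "AE x in lebesgue. norm (gauss a x * (cmod (ft s h x))\<^sup>2) \<le> norm (gauss a x * M\<^sup>2)"
      using M M0 by (intro AE_I2) (simp add: abs_mult mult_left_mono power_mono)
  qed measurable
  have fk: "ft s ?k x = cnj (of_real ?c * (LINT y|lebesgue. h y * of_real (gauss (1 / a) (y - x))))" for x
    unfolding ft_gauss_pairing[OF h a s, symmetric] unfolding ft_def[of s ?k]
    by (subst Bochner_Integration.integral_cnj[symmetric]) (simp add: cis_cnj mult_ac)
  have "complex_of_real (LINT w|lebesgue. gauss a w * (cmod (ft s h w))\<^sup>2)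
      = (LINT w|lebesgue. ?k w * ft s h w)"
    unfolding integral_of_real[OF I, symmetric]
    by (intro Bochner_Integration.integral_cong refl)
       (simp only: of_real_mult complex_norm_square mult_ac)
  also have "\<dots> = (LINT x|lebesgue. h x * ft s ?k x)"
    by (rule ft_multiplication_formula[OF h k])
  finally have e: "complex_of_real (LINT w|lebesgue. gauss a w * (cmod (ft s h w))\<^sup>2) = (LINT x|lebesgue. h x * ft s ?k x)" .
  have "(LINT w|lebesgue. gauss a w * (cmod (ft s h w))\<^sup>2) \<le> norm (LINT x|lebesgue. h x * ft s ?k x)"
    unfolding e[symmetric] norm_of_real by (rule abs_ge_self)
  then have "(\<integral>\<^sup>+w. ennreal (gauss a w * (cmod (ft s h w))\<^sup>2) \<partial>lebesgue) \<le> ennreal (norm (LINT x|lebesgue. h x * ft s ?k x))"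
    using I by (subst nn_integral_eq_integral) (auto intro: ennreal_leI)
  also have "\<dots> \<le> (\<integral>\<^sup>+x. ennreal (norm (h x * ft s ?k x)) \<partial>lebesgue)"
  proof (rule integral_norm_bound_ennreal)
    have "norm (ft s ?k x) \<le> (LINT w|lebesgue. cmod (?k w))" for x by (rule ft_bound[OF k])
    then show "integrable lebesgue (\<lambda>x. h x * ft s ?k x)"
      using ft_measurable(2)[OF k]
      by (intro Bochner_Integration.integrable_bound[OF integrable_mult_left[OF h, of "of_real (LINT w|lebesgue. cmod (?k w))"]])
         (auto simp: norm_mult intro!: mult_left_mono)
  qed
  also have "\<dots> \<le> (\<integral>\<^sup>+x. \<integral>\<^sup>+y. ennreal (cmod (h x) * cmod (h y) * ?G x y) \<partial>lebesgue \<partial>lebesgue)"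
  proof (rule nn_integral_mono)
    fix x :: 'a
    have gb: "gauss (1/a) z \<le> 1" for z :: 'a using a by (simp add: gauss_def)
    have i: "integrable lebesgue (\<lambda>y. h y * of_real (gauss (1 / a) (y - x)))"
      by (rule Bochner_Integration.integrable_bound[OF h]) (auto simp: norm_mult gb mult_left_le)
    have "ennreal (norm (h x * ft s ?k x)) = ennreal (cmod (h x) * ?c) * ennreal (norm (LINT y|lebesgue. h y * of_real (gauss (1 / a) (y - x))))"
      unfolding fk by (simp add: norm_mult mult_ac flip: ennreal_mult)
    also have "\<dots> \<le> ennreal (cmod (h x) * ?c) * (\<integral>\<^sup>+y. ennreal (norm (h y * of_real (gauss (1 / a) (y - x)))) \<partial>lebesgue)"
      by (intro mult_left_mono integral_norm_bound_ennreal i) auto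
    also have "\<dots> = (\<integral>\<^sup>+y. ennreal (cmod (h x) * ?c) * ennreal (norm (h y * of_real (gauss (1 / a) (y - x)))) \<partial>lebesgue)"
      by (rule nn_integral_cmult[symmetric]) measurable
    also have "\<dots> = (\<integral>\<^sup>+y. ennreal (cmod (h x) * cmod (h y) * ?G x y) \<partial>lebesgue)"
      by (intro nn_integral_cong) (simp add: norm_mult mult_ac flip: ennreal_mult)
    finally show "ennreal (norm (h x * ft s ?k x)) \<le> \<dots>" .
  qed
  \<comment> \<open>The inequality between geometric and arithmetic means decouples
    \<open>h x\<close> from \<open>h y\<close>. By symmetry of the kernel both resulting terms
    agree, and in each of them the kernel integrates to 1.\<close>
  also have "\<dots> \<le> (\<integral>\<^sup>+x. \<integral>\<^sup>+y. ennreal ((cmod (h x))\<^sup>2 / 2) * ennreal (?G x y) + ennreal ((cmod (h y))\<^sup>2 / 2) * ennreal (?G x y) \<partial>lebesgue \<partial>lebesgue)"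
  proof (intro nn_integral_mono)
    fix x y :: 'a
    have "cmod (h x) * cmod (h y) \<le> (cmod (h x))\<^sup>2 / 2 + (cmod (h y))\<^sup>2 / 2"
      using sum_squares_bound[of "cmod (h x)" "cmod (h y)"] by simp
    then have "cmod (h x) * cmod (h y) * ?G x y \<le> ((cmod (h x))\<^sup>2 / 2 + (cmod (h y))\<^sup>2 / 2) * ?G x y"
      by (rule mult_right_mono) simp
    then have "ennreal (cmod (h x) * cmod (h y) * ?G x y) \<le> ennreal ((cmod (h x))\<^sup>2 / 2 * ?G x y + (cmod (h y))\<^sup>2 / 2 * ?G x y)"
      by (intro ennreal_leI) (simp add: distrib_right)
    also have "\<dots> = ennreal ((cmod (h x))\<^sup>2 / 2) * ennreal (?G x y) + ennreal ((cmod (h y))\<^sup>2 / 2) * ennreal (?G x y)"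
      by (simp only: ennreal_plus ennreal_mult zero_le_power2 divide_nonneg_nonneg mult_nonneg_nonneg
            powr_ge_zero gauss_nonneg zero_le_numeral)
    finally show "ennreal (cmod (h x) * cmod (h y) * ?G x y) \<le> \<dots>" .
  qed
  also have "\<dots> = (\<integral>\<^sup>+x. \<integral>\<^sup>+y. ennreal ((cmod (h x))\<^sup>2 / 2) * ennreal (?G x y) \<partial>lebesgue \<partial>lebesgue)
     + (\<integral>\<^sup>+x. \<integral>\<^sup>+y. ennreal ((cmod (h y))\<^sup>2 / 2) * ennreal (?G x y) \<partial>lebesgue \<partial>lebesgue)"
  proof -
    have "(\<integral>\<^sup>+x. \<integral>\<^sup>+y. ennreal ((cmod (h x))\<^sup>2 / 2) * ennreal (?G x y) + ennreal ((cmod (h y))\<^sup>2 / 2) * ennreal (?G x y) \<partial>lebesgue \<partial>lebesgue)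
      = (\<integral>\<^sup>+x. (\<integral>\<^sup>+y. ennreal ((cmod (h x))\<^sup>2 / 2) * ennreal (?G x y) \<partial>lebesgue)
         + (\<integral>\<^sup>+y. ennreal ((cmod (h y))\<^sup>2 / 2) * ennreal (?G x y) \<partial>lebesgue) \<partial>lebesgue)"
      by (intro nn_integral_cong nn_integral_add) measurable
    also have "\<dots> = (\<integral>\<^sup>+x. \<integral>\<^sup>+y. ennreal ((cmod (h x))\<^sup>2 / 2) * ennreal (?G x y) \<partial>lebesgue \<partial>lebesgue)
     + (\<integral>\<^sup>+x. \<integral>\<^sup>+y. ennreal ((cmod (h y))\<^sup>2 / 2) * ennreal (?G x y) \<partial>lebesgue \<partial>lebesgue)"
      by (intro nn_integral_add) measurable
    finally show ?thesis .
  qed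
  also have "(\<integral>\<^sup>+x. \<integral>\<^sup>+y. ennreal ((cmod (h y))\<^sup>2 / 2) * ennreal (?G x y) \<partial>lebesgue \<partial>lebesgue)
     = (\<integral>\<^sup>+y. \<integral>\<^sup>+x. ennreal ((cmod (h y))\<^sup>2 / 2) * ennreal (?G x y) \<partial>lebesgue \<partial>lebesgue)"
    by (rule lebesgue_pair.Fubini'[OF mG])
  also have "\<dots> = (\<integral>\<^sup>+y. \<integral>\<^sup>+x. ennreal ((cmod (h y))\<^sup>2 / 2) * ennreal (?G y x) \<partial>lebesgue \<partial>lebesgue)"
    by (simp add: gauss_minus_commute)
  also have "(\<integral>\<^sup>+x. \<integral>\<^sup>+y. ennreal ((cmod (h x))\<^sup>2 / 2) * ennreal (?G x y) \<partial>lebesgue \<partial>lebesgue)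
     = (\<integral>\<^sup>+x. ennreal ((cmod (h x))\<^sup>2 / 2) \<partial>lebesgue)"
  proof (rule nn_integral_cong)
    fix x :: 'a
    have "(\<integral>\<^sup>+y. ennreal (?G x y) \<partial>lebesgue) = ennreal ?c * (\<integral>\<^sup>+y. ennreal (gauss (1/a) (y - x)) \<partial>lebesgue)"
      by (subst nn_integral_cmult[symmetric]) (auto simp: ennreal_mult)
    also have "\<dots> = ennreal (a powr (- real DIM('a) / 2) * (1 / a) powr (- real DIM('a) / 2))"
      using a by (subst nn_integral_gauss) (auto simp: ennreal_mult)
    also have "a powr (- real DIM('a) / 2) * (1 / a) powr (- real DIM('a) / 2) = 1"
      using a by (subst powr_mult[symmetric]) auto
    finally have "(\<integral>\<^sup>+y. ennreal (?G x y) \<partial>lebesgue) = 1" by simp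
    then show "(\<integral>\<^sup>+y. ennreal ((cmod (h x))\<^sup>2 / 2) * ennreal (?G x y) \<partial>lebesgue) = ennreal ((cmod (h x))\<^sup>2 / 2)"
      by (subst nn_integral_cmult) auto
  qed
  also have "(\<integral>\<^sup>+x. ennreal ((cmod (h x))\<^sup>2 / 2) \<partial>lebesgue) + (\<integral>\<^sup>+x. ennreal ((cmod (h x))\<^sup>2 / 2) \<partial>lebesgue) = ?N"
    by (subst nn_integral_add[symmetric]) (auto intro!: nn_integral_cong simp flip: ennreal_plus)
  finally show ?thesis .
qed

text \<open>Fatou's lemma removes the damping, as \<open>gauss (1 / n)\<close> tends to 1 pointwise
  while the bound does not depend on the parameter.\<close>

lemma ft_L2_le:
  fixes h :: "'a::euclidean_space \<Rightarrow> complex"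
  assumes h: "integrable lebesgue h" and s: "s\<^sup>2 = 4 * pi\<^sup>2"
  shows "(\<integral>\<^sup>+w. ennreal ((cmod (ft s h w))\<^sup>2) \<partial>lebesgue) \<le> (\<integral>\<^sup>+x. ennreal ((cmod (h x))\<^sup>2) \<partial>lebesgue)"
proof -
  let ?u = "\<lambda>n w. ennreal (gauss (1 / real (Suc n)) w * (cmod (ft s h w))\<^sup>2)"
  note ft_measurable(2)[OF h, measurable]
  have lim: "(\<lambda>n. ?u n w) \<longlonglongrightarrow> ennreal ((cmod (ft s h w))\<^sup>2)" for w
    using tendsto_mult[OF gauss_tendsto_1[of w] tendsto_const[of "(cmod (ft s h w))\<^sup>2"]]
    by (intro tendsto_ennrealI) simp
  have "(\<integral>\<^sup>+w. ennreal ((cmod (ft s h w))\<^sup>2) \<partial>lebesgue) = (\<integral>\<^sup>+w. liminf (\<lambda>n. ?u n w) \<partial>lebesgue)"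
    using lim by (intro nn_integral_cong lim_imp_Liminf[symmetric]) auto
  also have "\<dots> \<le> liminf (\<lambda>n. \<integral>\<^sup>+w. ?u n w \<partial>lebesgue)"
    by (rule nn_integral_liminf) measurable
  also have "\<dots> \<le> (\<integral>\<^sup>+x. ennreal ((cmod (h x))\<^sup>2) \<partial>lebesgue)"
    by (rule Liminf_le) (auto intro!: eventuallyI ft_gauss_L2_le[OF h _ s])
  finally show ?thesis .
qed

section \<open>Gaussians separate functions\<close>

lemma norm_sq_add_le: "(norm (x + y))\<^sup>2 \<le> 2 * (norm x)\<^sup>2 + 2 * (norm (y::'a::real_inner))\<^sup>2"
proof -
  have "(norm (x + y))\<^sup>2 + (norm (x - y))\<^sup>2 = 2 * (norm x)\<^sup>2 + 2 * (norm y)\<^sup>2"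
    by (simp add: power2_norm_eq_inner inner_simps inner_commute)
  then show ?thesis by (smt (verit) zero_le_power2)
qed

lemma gauss_mult: "gauss a x * gauss b x = gauss (a + b) x"
  by (simp add: gauss_def mult_exp_exp algebra_simps)

lemma gauss_le_1: "a \<ge> 0 \<Longrightarrow> gauss a x \<le> 1"
  by (simp add: gauss_def)

lemma integral_affine_lborel:
  fixes F :: "'a::euclidean_space \<Rightarrow> real" and t :: 'a
  assumes [measurable]: "F \<in> borel_measurable borel" and c: "c > 0"
  shows "(LINT x|lborel. F x) = c ^ DIM('a) * (LINT z|lborel. F (t + c *\<^sub>R z))"
proof -
  have "(LINT x|lborel. F x) = (LINT x|density (distr lborel borel (\<lambda>x::'a. t + c *\<^sub>R x)) (\<lambda>_. \<bar>c\<bar>^DIM('a)). F x)"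
    using lborel_affine[of c t] c by simp
  also have "\<dots> = c ^ DIM('a) * (LINT z|lborel. F (t + c *\<^sub>R z))"
    using c by (subst integral_density) (auto simp: integral_distr)
  finally show ?thesis .
qed

text \<open>
  \<open>J n\<close> in the proof is \<open>\<psi>\<close> mollified at scale \<open>\<delta> n\<close>: it is a superposition of shifted
  Gaussians, hence orthogonal to \<open>u\<close>, and it converges to \<open>\<psi>\<close> dominated by a fixed Gaussian.
\<close>
lemma gauss_orthogonal_imp_orthogonal:
  fixes u :: "'a::euclidean_space \<Rightarrow> complex" and \<psi> :: "'a \<Rightarrow> real"
  assumes u[measurable]: "u \<in> borel_measurable lebesgue"
    and ui: "\<And>c. c > 0 \<Longrightarrow> integrable lebesgue (\<lambda>y. u y * of_real (gauss c y))"
    and orth: "\<And>a x. a > 0 \<Longrightarrow> (LINT y|lebesgue. u y * of_real (gauss a (y - x))) = 0"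
    and \<psi>[measurable]: "\<psi> \<in> borel_measurable borel"
    and \<psi>0: "\<And>x. 0 \<le> \<psi> x" and \<psi>1: "\<And>x. \<psi> x \<le> gauss 1 x"
    and cont: "AE y in lebesgue. isCont \<psi> y"
  shows "(LINT y|lebesgue. u y * of_real (\<psi> y)) = 0"
proof -
  \<comment> \<open>The shift by 2 gives \<open>(\<delta> n)\<^sup>2 \<le> 1/2\<close>, which the
    domination below requires.\<close>
  define \<delta> where "\<delta> n = 1 / sqrt (real n + 2)" for n
  have \<delta>: "\<delta> n > 0" "(\<delta> n)\<^sup>2 \<le> 1/2" "1 / (\<delta> n)\<^sup>2 = real n + 2" for n
    by (auto simp: \<delta>_def power_divide divide_simps)
  have \<delta>lim: "\<delta> \<longlonglongrightarrow> 0"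
    unfolding \<delta>_def by real_asymp
  define J where "J n y = (LINT z|lebesgue. \<psi> (y + \<delta> n *\<^sub>R z) * gauss 1 z)" for n and y :: 'a
  have \<psi>le1: "\<psi> x \<le> 1" for x using \<psi>1[of x] gauss_le_1[of 1 x] by simp
  have g1: "integrable lebesgue (\<lambda>z::'a. gauss 1 z)" "(LINT z|lebesgue. gauss 1 (z::'a)) = 1"
    using gauss_integrable[of 1 "0::'a"] integral_gauss[of 1 "0::'a"] by auto
  have gh: "integrable lebesgue (\<lambda>z::'a. gauss (1/2) z)"
    using gauss_integrable[of "1/2" "0::'a"] by auto
  define C where "C = (LINT z|lebesgue. gauss (1/2) (z::'a))"
  have \<psi>l[measurable]: "\<psi> \<in> borel_measurable lebesgue" by (rule borel_measurable_lebesgueI) measurable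
  have Fm: "(\<lambda>z. \<psi> (y + d *\<^sub>R z) * gauss 1 z) \<in> borel_measurable lebesgue" for y d
    by (rule borel_measurable_lebesgueI) measurable
  \<comment> \<open>Since \<open>\<psi>\<close> lies below \<open>gauss 1\<close>, part of the decay
    in \<open>z\<close> can be given up for decay in \<open>y\<close> that is uniform in
    \<open>n\<close>.\<close>
  have bound: "\<psi> (y + \<delta> n *\<^sub>R z) * gauss 1 z \<le> gauss (1/2) y * gauss (1/2) z" for n y z
  proof -
    have "\<psi> (y + \<delta> n *\<^sub>R z) * gauss 1 z \<le> gauss 1 (y + \<delta> n *\<^sub>R z) * gauss 1 z"
      by (intro mult_right_mono \<psi>1) simp
    also have "\<dots> \<le> gauss (1/2) y * gauss (1/2) z"
    proof -
      have "(norm y)\<^sup>2 \<le> 2 * (norm (y + \<delta> n *\<^sub>R z))\<^sup>2 + 2 * (norm (\<delta> n *\<^sub>R z))\<^sup>2"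
        using norm_sq_add_le[of "y + \<delta> n *\<^sub>R z" "- (\<delta> n *\<^sub>R z)"] by simp
      also have "(norm (\<delta> n *\<^sub>R z))\<^sup>2 \<le> 1/2 * (norm z)\<^sup>2"
        unfolding norm_scaleR power_mult_distrib power2_abs by (intro mult_right_mono \<delta>) simp
      finally have "(norm y)\<^sup>2 \<le> 2 * (norm (y + \<delta> n *\<^sub>R z))\<^sup>2 + (norm z)\<^sup>2" by simp
      then have "pi * (norm y)\<^sup>2 \<le> pi * (2 * (norm (y + \<delta> n *\<^sub>R z))\<^sup>2 + (norm z)\<^sup>2)"
        by (intro mult_left_mono) auto
      then show ?thesis by (simp add: gauss_def mult_exp_exp distrib_left)
    qed
    finally show ?thesis .
  qed
  have Jb: "norm (J n y) \<le> gauss (1/2) y * C" for n y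
  proof -
    have "norm (J n y) \<le> (LINT z|lebesgue. norm (\<psi> (y + \<delta> n *\<^sub>R z) * gauss 1 z))"
      unfolding J_def by (rule integral_norm_bound)
    also have "\<dots> \<le> (LINT z|lebesgue. gauss (1/2) y * gauss (1/2) (z::'a))"
    proof (rule Bochner_Integration.integral_mono)
      show i: "integrable lebesgue (\<lambda>z::'a. gauss (1/2) y * gauss (1/2) z)" using gh by simp
      show "integrable lebesgue (\<lambda>z. norm (\<psi> (y + \<delta> n *\<^sub>R z) * gauss 1 z))"
        by (rule Bochner_Integration.integrable_bound[OF i])
           (use Fm bound \<psi>0 in \<open>auto simp: abs_mult\<close>)
    qed (use bound \<psi>0 in \<open>auto simp: abs_mult\<close>)
    finally show ?thesis by (simp add: C_def)
  qed
  have Jlim: "(\<lambda>n. J n y) \<longlonglongrightarrow> \<psi> y" if "isCont \<psi> y" for y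
  proof -
    have "(\<lambda>n. LINT z|lebesgue. \<psi> (y + \<delta> n *\<^sub>R z) * gauss 1 z) \<longlonglongrightarrow> (LINT z|lebesgue. \<psi> y * gauss 1 (z::'a))"
    proof (rule integral_dominated_convergence[OF _ _ g1(1)])
      have "(\<lambda>n. y + \<delta> n *\<^sub>R z) \<longlonglongrightarrow> y + 0 *\<^sub>R z" for z
        by (intro tendsto_intros \<delta>lim)
      then have "(\<lambda>n. y + \<delta> n *\<^sub>R z) \<longlonglongrightarrow> y" for z by simp
      from isCont_tendsto_compose[OF that this]
      have "(\<lambda>n. \<psi> (y + \<delta> n *\<^sub>R z)) \<longlonglongrightarrow> \<psi> y" for z .
      then show "AE z in lebesgue. (\<lambda>n. \<psi> (y + \<delta> n *\<^sub>R z) * gauss 1 z) \<longlonglongrightarrow> \<psi> y * gauss 1 z"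
        by (intro AE_I2 tendsto_intros)
      show "AE z in lebesgue. norm (\<psi> (y + \<delta> n *\<^sub>R z) * gauss 1 z) \<le> gauss 1 z" for n
        using \<psi>0 \<psi>le1 by (intro AE_I2) (simp add: abs_mult mult_left_le_one_le)
    qed (use Fm in auto)
    then show ?thesis using g1 by (simp add: J_def)
  qed
  have J0: "(LINT y|lebesgue. u y * of_real (J n y)) = 0" for n
  proof -
    define a where "a = real n + 2"
    have a: "a \<ge> 1" "a > 0" "a * (\<delta> n)\<^sup>2 = 1" using \<delta>[of n] by (auto simp: a_def field_simps)
    \<comment> \<open>Substituting \<open>x = y + \<delta> n *\<^sub>R z\<close> rescales
      \<open>gauss a\<close> to \<open>gauss 1\<close>, because
      \<open>a * (\<delta> n)\<^sup>2 = 1\<close>.\<close>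
    have Jeq: "(LINT x|lebesgue. \<psi> x * gauss a (y - x)) = \<delta> n ^ DIM('a) * J n y" for y
    proof -
      have "(LINT x|lebesgue. \<psi> x * gauss a (y - x)) = (LINT x|lborel. \<psi> x * gauss a (y - x))"
        by (rule integral_completion) measurable
      also have "\<dots> = \<delta> n ^ DIM('a) * (LINT z|lborel. \<psi> (y + \<delta> n *\<^sub>R z) * gauss a (y - (y + \<delta> n *\<^sub>R z)))"
        by (rule integral_affine_lborel) (use \<delta> in auto)
      also have "(\<lambda>z. \<psi> (y + \<delta> n *\<^sub>R z) * gauss a (y - (y + \<delta> n *\<^sub>R z))) = (\<lambda>z. \<psi> (y + \<delta> n *\<^sub>R z) * gauss 1 z)"
        using a(3) by (simp add: gauss_def power_mult_distrib mult.assoc[symmetric] fun_eq_iff)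
      also have "(LINT z|lborel. \<psi> (y + \<delta> n *\<^sub>R z) * gauss 1 z) = J n y"
        unfolding J_def by (rule integral_completion[symmetric]) measurable
      finally show ?thesis .
    qed
    have [measurable]: "(\<lambda>p::'a \<times> 'a. complex_of_real (\<psi> (snd p) * gauss a (fst p - snd p))) \<in> borel_measurable (lebesgue \<Otimes>\<^sub>M lebesgue)"
      by (rule borel_measurable_lebesgue_pairI) measurable
    have I: "integrable (lebesgue \<Otimes>\<^sub>M lebesgue) (\<lambda>(y, x). u y * of_real (\<psi> x * gauss a (y - x)))"
    proof (rule Bochner_Integration.integrable_bound)
      show "integrable (lebesgue \<Otimes>\<^sub>M lebesgue) (\<lambda>p. (u (fst p) * of_real (gauss (1/4) (fst p))) * complex_of_real (gauss (1/2) (snd p :: 'a)))"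
        by (intro integrable_lebesgue_pair_mult ui) (use gh in auto)
      \<comment> \<open>Half of the decay in \<open>x\<close> is kept; the rest, together with
        \<open>gauss a (y - x)\<close>, is traded for decay in \<open>y\<close>. The majorant
        becomes a product whose \<open>y\<close> factor is integrable against
        \<open>u\<close>.\<close>
      have "\<psi> x * gauss a (y - x) \<le> gauss (1/4) y * gauss (1/2) x" for x y
      proof -
        have "\<psi> x * gauss a (y - x) \<le> gauss 1 x * gauss a (y - x)"
          by (intro mult_right_mono \<psi>1) simp
        also have "\<dots> \<le> gauss (1/4) y * gauss (1/2) x"
        proof -
          have "(norm y)\<^sup>2 \<le> 2 * (norm x)\<^sup>2 + 2 * (norm (y - x))\<^sup>2"
            using norm_sq_add_le[of x "y - x"] by simp
          also have "(norm (y - x))\<^sup>2 \<le> a * (norm (y - x))\<^sup>2"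
            using a by (simp add: mult_le_cancel_right1)
          finally have "(norm y)\<^sup>2 \<le> 2 * (norm x)\<^sup>2 + 2 * (a * (norm (y - x))\<^sup>2)" by simp
          moreover have "0 \<le> a * (norm (y - x))\<^sup>2" using a by simp
          ultimately have "(norm y)\<^sup>2 / 4 + (norm x)\<^sup>2 / 2 \<le> (norm x)\<^sup>2 + a * (norm (y - x))\<^sup>2"
            by linarith
          then have "pi * ((norm y)\<^sup>2 / 4 + (norm x)\<^sup>2 / 2) \<le> pi * ((norm x)\<^sup>2 + a * (norm (y - x))\<^sup>2)"
            by (intro mult_left_mono) auto
          then show ?thesis by (simp add: gauss_def mult_exp_exp distrib_left mult.assoc)
        qed
        finally show ?thesis .
      qed
      then show "AE p in lebesgue \<Otimes>\<^sub>M lebesgue. norm (case p of (y, x) \<Rightarrow> u y * of_real (\<psi> x * gauss a (y - x)))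
          \<le> norm ((u (fst p) * of_real (gauss (1/4) (fst p))) * complex_of_real (gauss (1/2) (snd p)))"
        using \<psi>0 by (intro AE_I2) (auto simp: norm_mult abs_mult mult.assoc intro!: mult_left_mono)
      show "(\<lambda>(y, x). u y * of_real (\<psi> x * gauss a (y - x))) \<in> borel_measurable (lebesgue \<Otimes>\<^sub>M lebesgue)"
        unfolding case_prod_beta' by measurable
    qed
    have "of_real (\<delta> n ^ DIM('a)) * (LINT y|lebesgue. u y * of_real (J n y))
        = (LINT y|lebesgue. u y * of_real (LINT x|lebesgue. \<psi> x * gauss a (y - x)))"
      unfolding Jeq by (subst integral_mult_right_zero[symmetric]) (simp add: mult_ac)
    also have "\<dots> = (LINT y|lebesgue. LINT x|lebesgue. u y * of_real (\<psi> x * gauss a (y - x)))"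
      by (simp only: integral_mult_right_zero integral_complex_of_real)
    also have "\<dots> = (LINT x|lebesgue. LINT y|lebesgue. u y * of_real (\<psi> x * gauss a (y - x)))"
      by (rule lebesgue_pair.Fubini_integral[OF I, symmetric])
    also have "\<dots> = (LINT x|lebesgue. of_real (\<psi> x) * (LINT y|lebesgue. u y * of_real (gauss a (y - x))))"
      by (subst integral_mult_right_zero[symmetric]) (simp add: mult_ac)
    also have "\<dots> = 0" using orth[OF a(2)] by simp
    finally show ?thesis using \<delta>[of n] by simp
  qed
  have [measurable]: "J n \<in> borel_measurable lebesgue" for n
    unfolding J_def
  proof (rule lebesgue.borel_measurable_lebesgue_integral)
    show "(\<lambda>(y, z). \<psi> (y + \<delta> n *\<^sub>R z) * gauss 1 z) \<in> borel_measurable (lebesgue \<Otimes>\<^sub>M lebesgue)"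
      by (rule borel_measurable_lebesgue_pairI) measurable
  qed
  have "(\<lambda>n. LINT y|lebesgue. u y * of_real (J n y)) \<longlonglongrightarrow> (LINT y|lebesgue. u y * of_real (\<psi> y))"
  proof (rule integral_dominated_convergence)
    show "integrable lebesgue (\<lambda>y. norm (u y * of_real (gauss (1/2) y)) * C)"
      using ui[of "1/2"] by (intro integrable_mult_left integrable_norm) auto
    show "AE y in lebesgue. (\<lambda>n. u y * of_real (J n y)) \<longlonglongrightarrow> u y * of_real (\<psi> y)"
      using cont by eventually_elim (intro tendsto_intros Jlim)
    show "AE y in lebesgue. norm (u y * of_real (J n y)) \<le> norm (u y * of_real (gauss (1/2) y)) * C" for n
      using Jb[of n] by (intro AE_I2) (simp add: norm_mult mult.assoc mult_left_mono)
  qed measurable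
  then show ?thesis using J0 LIMSEQ_unique[OF _ tendsto_const] by simp
qed

text \<open>The integrable function \<open>v = u * gauss 1\<close> has integral zero over every box:
  the box indicator times \<open>gauss 1\<close> is an admissible \<open>\<psi>\<close>, being
  discontinuous only on the null frontier of the box. Boxes are intersection-stable and generate the
  Borel sets, so \<open>v\<close> integrates to zero over every Lebesgue set, hence vanishes almost
  everywhere, and so does \<open>u\<close>.\<close>

lemma gauss_separating:
  fixes u :: "'a::euclidean_space \<Rightarrow> complex"
  assumes u[measurable]: "u \<in> borel_measurable lebesgue"
    and ui: "\<And>c. c > 0 \<Longrightarrow> integrable lebesgue (\<lambda>y. u y * of_real (gauss c y))"
    and orth: "\<And>a x. a > 0 \<Longrightarrow> (LINT y|lebesgue. u y * of_real (gauss a (y - x))) = 0"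
  shows "AE y in lebesgue. u y = 0"
proof -
  define v where "v y = u y * of_real (gauss 1 y)" for y
  have v: "integrable lebesgue v" unfolding v_def[abs_def] by (rule ui) simp
  note orthogonal = gauss_orthogonal_imp_orthogonal[OF u ui orth]
  have gauss_cont: "isCont (gauss 1) y" for y :: 'a
    unfolding gauss_def[abs_def] by (intro continuous_intros)
  \<comment> \<open>Here \<open>\<psi>\<close> is \<open>gauss 1\<close> itself; the value over the
    whole space handles complements in the Dynkin argument.\<close>
  have total: "(LINT y|lebesgue. v y) = 0"
    unfolding v_def by (rule orthogonal) (auto simp: gauss_cont)
  let ?E = "range (\<lambda>(a, b). box a b::'a set)"
  have box: "(LINT y:box a b|lebesgue. v y) = 0" for a b :: 'a
  proof -
    let ?\<psi> = "\<lambda>y. indicator (box a b) y * gauss 1 y"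
    have "(LINT y|lebesgue. u y * of_real (?\<psi> y)) = 0"
    proof (rule orthogonal)
      have "negligible (frontier (box a b))"
        by (rule negligible_convex_frontier) simp
      then have "AE y in lebesgue. y \<notin> frontier (box a b)"
        by (simp add: negligible_iff_null_sets AE_not_in)
      then show "AE y in lebesgue. isCont ?\<psi> y"
        by eventually_elim (intro continuous_mult gauss_cont, simp add: isCont_indicator)
    qed (auto simp: indicator_def)
    moreover have "u y * of_real (?\<psi> y) = indicator (box a b) y *\<^sub>R v y" for y
      by (auto simp: v_def indicator_def)
    ultimately show ?thesis by (simp add: set_lebesgue_integral_def)
  qed
  have borel: "(LINT y:A|lebesgue. v y) = 0" if "A \<in> sets borel" for A :: "'a set"
  proof -
    have S: "sets borel = sigma_sets UNIV ?E" by (simp add: borel_eq_box)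
    have si: "set_integrable lebesgue B v" if "B \<in> sets borel" for B
      using integrable_mult_indicator[OF _ v, of B] that by (auto simp: set_integrable_def)
    have "Int_stable ?E" by (auto simp: Int_stable_def box_Int_box)
    moreover have "?E \<subseteq> Pow UNIV" by simp
    moreover from that have "A \<in> sigma_sets UNIV ?E" by (simp only: S)
    ultimately show ?thesis
    proof (induction rule: sigma_sets_induct_disjoint)
      case (basic B)
      then show ?case using box by auto
    next
      case empty
      show ?case by (simp add: set_lebesgue_integral_def)
    next
      case (compl B)
      then have B: "B \<in> sets borel" by (simp add: S)
      have "(LINT y:B \<union> (UNIV - B)|lebesgue. v y) = (LINT y:B|lebesgue. v y) + (LINT y:UNIV - B|lebesgue. v y)"
        using B by (intro set_integral_Un si) auto
      then show ?case using compl total by (simp add: set_lebesgue_integral_def)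
    next
      case (union B)
      then have "\<And>i. B i \<in> sets borel" by (auto simp: S)
      then have "(LINT y:(\<Union>i. B i)|lebesgue. v y) = (\<Sum>i. (LINT y:B i|lebesgue. v y))"
        using union(1) by (intro lebesgue_integral_countable_add si) (auto simp: disjoint_family_on_def)
      then show ?case using union by simp
    qed
  qed
  have "(LINT y:A|lebesgue. v y) = 0" if "A \<in> sets lebesgue" for A
  proof -
    from that obtain S N N' where A: "A = S \<union> N" "N \<subseteq> N'" "N' \<in> null_sets lborel" "S \<in> sets lborel"
      by (rule sets_completionE)
    have "N' \<in> null_sets lebesgue" using A(3) by (rule null_sets_completionI)
    then have ae: "AE y in lebesgue. y \<notin> N'" by (rule AE_not_in)
    have "(LINT y:A|lebesgue. v y) = (LINT y:S|lebesgue. v y)"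
      unfolding set_lebesgue_integral_def
    proof (rule integral_cong_AE)
      show "AE y in lebesgue. indicator A y *\<^sub>R v y = indicator S y *\<^sub>R v y"
        using ae by eventually_elim (use A(1,2) in \<open>auto simp: indicator_def\<close>)
      have [measurable]: "v \<in> borel_measurable lebesgue" "A \<in> sets lebesgue" "S \<in> sets lebesgue"
        using v that A(4) by auto
      show "(\<lambda>y. indicat_real A y *\<^sub>R v y) \<in> borel_measurable lebesgue"
        "(\<lambda>y. indicat_real S y *\<^sub>R v y) \<in> borel_measurable lebesgue" by measurable
    qed
    then show ?thesis using borel A(4) by simp
  qed
  then have "AE y in lebesgue. v y = 0" by (intro lebesgue.density_zero v)
  then show ?thesis
    by eventually_elim (simp add: v_def gauss_def)
qed

section \<open>The Fourier transform on \<open>L\<^sup>2\<close>\<close>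

text \<open>The product is at most the sum of the two squares, and the square of
  \<open>gauss a\<close> is \<open>gauss (2 * a)\<close>.\<close>

lemma L2_gauss_integrable:
  fixes f :: "'a::euclidean_space \<Rightarrow> complex"
  assumes "L2 f" and a: "a > 0"
  shows "integrable lebesgue (\<lambda>y. f y * of_real (gauss a (y - x)))"
proof -
  have f [measurable]: "f \<in> borel_measurable lebesgue" and f2: "integrable lebesgue (\<lambda>x. (cmod (f x))\<^sup>2)"
    using assms by (auto simp: L2_def)
  show ?thesis
  proof (rule Bochner_Integration.integrable_bound)
    show "integrable lebesgue (\<lambda>y. (cmod (f y))\<^sup>2 + gauss (2 * a) (y - x))"
      using a by (intro Bochner_Integration.integrable_add f2 gauss_integrable) simp
    have "cmod (f y) * gauss a (y - x) \<le> (cmod (f y))\<^sup>2 + gauss (2 * a) (y - x)" for y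
    proof -
      have "(gauss a (y - x))\<^sup>2 = gauss (2 * a) (y - x)"
        by (simp add: power2_eq_square gauss_mult)
      moreover have "0 \<le> cmod (f y) * gauss a (y - x)" by simp
      ultimately show ?thesis
        using sum_squares_bound[of "cmod (f y)" "gauss a (y - x)"] by linarith
    qed
    then show "AE y in lebesgue. norm (f y * of_real (gauss a (y - x))) \<le> norm ((cmod (f y))\<^sup>2 + gauss (2 * a) (y - x))"
      by (intro AE_I2) (simp add: norm_mult)
  qed measurable
qed

text \<open>On \<open>A\<close> the modulus is at most its square plus 1. This is applied to balls
  and to the support of a function.\<close>

lemma L2_finite_measure_integrable:
  fixes f :: "'a::euclidean_space \<Rightarrow> complex"
  assumes "L2 f" and A [measurable]: "A \<in> sets lebesgue" and fin: "emeasure lebesgue A < \<infinity>"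
  shows "integrable lebesgue (\<lambda>x. indicator A x *\<^sub>R f x)"
proof -
  have f [measurable]: "f \<in> borel_measurable lebesgue" and f2: "integrable lebesgue (\<lambda>x. (cmod (f x))\<^sup>2)"
    using assms by (auto simp: L2_def)
  show ?thesis
  proof (rule Bochner_Integration.integrable_bound)
    show "integrable lebesgue (\<lambda>x. (cmod (f x))\<^sup>2 + indicat_real A x)"
      using fin by (intro Bochner_Integration.integrable_add f2) (simp add: integrable_indicator_iff)
    have "cmod (f x) \<le> (cmod (f x))\<^sup>2 + 1" for x
      using sum_squares_bound[of "cmod (f x)" 1] norm_ge_zero[of "f x"] by (simp, linarith)
    then show "AE x in lebesgue. norm (indicator A x *\<^sub>R f x) \<le> norm ((cmod (f x))\<^sup>2 + indicat_real A x)"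
      by (intro AE_I2) (simp add: indicator_def)
  qed measurable
qed

lemma fourier_trunc_eq_ft:
  "fourier_trunc f R = ft (- 2 * pi) (\<lambda>x. indicator (ball 0 R) x *\<^sub>R f x)"
  unfolding fourier_trunc_def ft_def set_lebesgue_integral_def
  by (intro ext Bochner_Integration.integral_cong) (auto simp: indicator_def)

lemma L2_trunc_integrable:
  fixes f :: "'a::euclidean_space \<Rightarrow> complex"
  assumes "L2 f"
  shows "integrable lebesgue (\<lambda>x. indicator (ball 0 R) x *\<^sub>R f x)"
  by (rule L2_finite_measure_integrable[OF assms]) (use emeasure_lborel_ball_finite[of "0::'a" R] in auto)

lemma is_fourier_L2_sequentially:
  assumes "is_fourier_L2 f g"
  shows "(\<lambda>n. \<integral>\<^sup>+ w. ennreal ((cmod (g w - fourier_trunc f (real n) w))\<^sup>2) \<partial>lebesgue) \<longlonglongrightarrow> 0"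
  using assms unfolding is_fourier_L2_def
  by (auto intro: filterlim_compose[OF _ filterlim_real_sequentially])

lemma indicator_ball_eventually:
  fixes x :: "'a::real_normed_vector"
  shows "eventually (\<lambda>n. indicat_real (ball 0 (real n)) x = 1) sequentially"
proof -
  obtain m :: nat where "norm x < real m" using reals_Archimedean2 by blast
  then have "indicat_real (ball 0 (real n)) x = 1" if "n \<ge> m" for n
    using that by (auto simp: indicator_def)
  then show ?thesis by (auto simp: eventually_sequentially)
qed

text \<open>Extends \<open>ft_gauss_pairing\<close> to L2 by letting the truncation radius tend to
  infinity: the right side converges by dominated convergence, the left side by Cauchy-Schwarz, as
  the Gaussian is itself in L2.\<close>

lemma is_fourier_L2_gauss_pairing:
  fixes f g :: "'a::euclidean_space \<Rightarrow> complex"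
  assumes f: "L2 f" and fg: "is_fourier_L2 f g" and a: "a > 0"
  shows "(LINT w|lebesgue. of_real (gauss a w) * cis (2 * pi * (w \<bullet> x)) * g w)
     = of_real (a powr (- real DIM('a) / 2)) * (LINT y|lebesgue. f y * of_real (gauss (1 / a) (y - x)))"
proof (rule LIMSEQ_unique)
  let ?f = "\<lambda>n x. indicator (ball 0 (real n)) x *\<^sub>R f x"
  let ?g = "\<lambda>n. fourier_trunc f (real n)"
  let ?e = "\<lambda>w. of_real (gauss a w) * cis (2 * pi * (w \<bullet> x))"
  have g: "L2 g" using fg by (simp add: is_fourier_L2_def)
  have fm [measurable]: "f \<in> borel_measurable lebesgue" and gm [measurable]: "g \<in> borel_measurable lebesgue"
    using f g by (auto simp: L2_def)
  have em [measurable]: "?e \<in> borel_measurable lebesgue"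
    by (rule borel_measurable_lebesgueI) measurable
  have gb: "(\<lambda>y. complex_of_real (gauss b (y - x))) \<in> borel_measurable lebesgue" for b
    by (rule borel_measurable_lebesgueI) measurable
  note fi = L2_trunc_integrable[OF f]
  have hm [measurable]: "?g n \<in> borel_measurable lebesgue" for n
    unfolding fourier_trunc_eq_ft by (rule ft_measurable(2)[OF fi])
  have pairing: "(LINT w|lebesgue. ?e w * ?g n w)
      = of_real (a powr (- real DIM('a) / 2)) * (LINT y|lebesgue. ?f n y * of_real (gauss (1 / a) (y - x)))" for n
    using ft_gauss_pairing[OF fi[of "real n"] a, where s="- 2 * pi" and x=x] by (simp add: fourier_trunc_eq_ft power_mult_distrib)
  have "(\<lambda>n. LINT y|lebesgue. ?f n y * of_real (gauss (1 / a) (y - x))) \<longlonglongrightarrow> (LINT y|lebesgue. f y * of_real (gauss (1 / a) (y - x)))"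
  proof (rule integral_dominated_convergence)
    show "integrable lebesgue (\<lambda>y. norm (f y * of_real (gauss (1 / a) (y - x))))"
      using L2_gauss_integrable[OF f, of "1/a" x] a by (intro integrable_norm) auto
    have "(\<lambda>n. ?f n y * of_real (gauss (1 / a) (y - x))) \<longlonglongrightarrow> f y * of_real (gauss (1 / a) (y - x))" for y
      by (rule tendsto_eventually) (use indicator_ball_eventually[of y] in eventually_elim, simp)
    then show "AE y in lebesgue. (\<lambda>n. ?f n y * of_real (gauss (1 / a) (y - x))) \<longlonglongrightarrow> f y * of_real (gauss (1 / a) (y - x))"
      by simp
    show "AE y in lebesgue. norm (?f n y * of_real (gauss (1 / a) (y - x))) \<le> norm (f y * of_real (gauss (1 / a) (y - x)))" for n
      by (intro AE_I2) (auto simp: indicator_def norm_mult)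
    show "(\<lambda>y. f y * of_real (gauss (1 / a) (y - x))) \<in> borel_measurable lebesgue"
      by (intro borel_measurable_times fm gb)
    show "(\<lambda>y. ?f n y * of_real (gauss (1 / a) (y - x))) \<in> borel_measurable lebesgue" for n
      by (intro borel_measurable_times borel_measurable_integrable[OF fi] gb)
  qed
  then show "(\<lambda>n. LINT w|lebesgue. ?e w * ?g n w) \<longlonglongrightarrow> 
     of_real (a powr (- real DIM('a) / 2)) * (LINT y|lebesgue. f y * of_real (gauss (1 / a) (y - x)))"
    unfolding pairing by (intro tendsto_intros)
  have ei: "integrable lebesgue (\<lambda>w. ?e w * g w)"
  proof (rule Bochner_Integration.integrable_bound[OF L2_gauss_integrable[OF g a, of 0]])
    show "(\<lambda>w. ?e w * g w) \<in> borel_measurable lebesgue" by (intro borel_measurable_times[OF em gm])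
  qed (simp add: norm_mult mult.commute)
  have eni: "integrable lebesgue (\<lambda>w. ?e w * ?g n w)" for n
  proof (rule Bochner_Integration.integrable_bound)
    show "integrable lebesgue (\<lambda>w::'a. gauss a w * (LINT x|lebesgue. cmod (?f n x)))"
      using gauss_integrable[OF a, of "0::'a"] by simp
    show "AE w in lebesgue. norm (?e w * ?g n w) \<le> norm (gauss a w * (LINT x|lebesgue. cmod (?f n x)))"
      using ft_bound[OF fi[of "real n"]] unfolding fourier_trunc_eq_ft
      by (intro AE_I2) (simp add: norm_mult abs_mult mult_left_mono)
  qed measurable
  let ?D = "\<lambda>n. \<integral>\<^sup>+ w. ennreal ((cmod (g w - ?g n w))\<^sup>2) \<partial>lebesgue"
  \<comment> \<open>\<open>?c\<close> is the squared L2 norm of \<open>gauss a\<close>, the constant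
    in the Cauchy-Schwarz estimate below.\<close>
  let ?c = "\<integral>\<^sup>+ w. ennreal (gauss (2 * a) w) \<partial>(lebesgue :: 'a measure)"
  have "?c < \<top>" using nn_integral_gauss[of "2 * a" "0::'a"] a by simp
  then have "(\<lambda>n. ?c * ?D n) \<longlonglongrightarrow> ?c * 0"
    by (intro ennreal_tendsto_cmult is_fourier_L2_sequentially[OF fg])
  then have lim0: "(\<lambda>n. ?c * ?D n) \<longlonglongrightarrow> 0" by simp
  have le: "ennreal ((cmod ((LINT w|lebesgue. ?e w * g w) - (LINT w|lebesgue. ?e w * ?g n w)))\<^sup>2) \<le> ?c * ?D n" for n
  proof -
    have "ennreal (cmod ((LINT w|lebesgue. ?e w * g w) - (LINT w|lebesgue. ?e w * ?g n w)))
       = ennreal (cmod (LINT w|lebesgue. ?e w * g w - ?e w * ?g n w))"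
      by (simp add: Bochner_Integration.integral_diff[OF ei eni])
    also have "\<dots> \<le> (\<integral>\<^sup>+ w. ennreal (cmod (?e w * g w - ?e w * ?g n w)) \<partial>lebesgue)"
      by (intro integral_norm_bound_ennreal Bochner_Integration.integrable_diff ei eni)
    also have "\<dots> = (\<integral>\<^sup>+ w. ennreal (gauss a w) * ennreal (cmod (g w - ?g n w)) \<partial>lebesgue)"
      by (intro nn_integral_cong) (simp add: norm_mult flip: right_diff_distrib ennreal_mult)
    finally have "(ennreal (cmod ((LINT w|lebesgue. ?e w * g w) - (LINT w|lebesgue. ?e w * ?g n w))))\<^sup>2
       \<le> (\<integral>\<^sup>+ w. ennreal (gauss a w) * ennreal (cmod (g w - ?g n w)) \<partial>lebesgue)\<^sup>2"
      by (rule power_mono) simp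
    also have "\<dots> \<le> (\<integral>\<^sup>+ w. (ennreal (gauss a (w::'a)))\<^sup>2 \<partial>lebesgue) * (\<integral>\<^sup>+ w. (ennreal (cmod (g w - ?g n w)))\<^sup>2 \<partial>lebesgue)"
      by (rule Cauchy_Schwarz_nn_integral) measurable
    also have "\<dots> = ?c * ?D n"
      by (simp add: ennreal_power) (simp add: power2_eq_square gauss_mult)
    finally show ?thesis by (simp add: ennreal_power)
  qed
  have "(\<lambda>n. ennreal ((cmod ((LINT w|lebesgue. ?e w * g w) - (LINT w|lebesgue. ?e w * ?g n w)))\<^sup>2)) \<longlonglongrightarrow> 0"
    by (rule tendsto_sandwich[OF _ _ tendsto_const lim0]) (use le in auto)
  then have "(\<lambda>n. (cmod ((LINT w|lebesgue. ?e w * g w) - (LINT w|lebesgue. ?e w * ?g n w)))\<^sup>2) \<longlonglongrightarrow> 0"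
    by (simp add: ennreal_0[symmetric] tendsto_ennreal_iff del: ennreal_0)
  then have "(\<lambda>n. cmod ((LINT w|lebesgue. ?e w * g w) - (LINT w|lebesgue. ?e w * ?g n w))) \<longlonglongrightarrow> 0"
    by simp
  then have "(\<lambda>n. (LINT w|lebesgue. ?e w * g w) - (LINT w|lebesgue. ?e w * ?g n w)) \<longlonglongrightarrow> 0"
    by (rule tendsto_norm_zero_cancel)
  from tendsto_diff[OF tendsto_const[of "LINT w|lebesgue. ?e w * g w"] this]
  show "(\<lambda>n. LINT w|lebesgue. ?e w * ?g n w) \<longlonglongrightarrow> (LINT w|lebesgue. ?e w * g w)"
    by simp
qed

text \<open>For integrable \<open>f\<close> the truncated transforms converge pointwise to the
  Fourier integral and in L2 to \<open>g\<close>; Fatou's lemma identifies the two limits.\<close>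

lemma fourier_L2_eq_ft:
  fixes f g :: "'a::euclidean_space \<Rightarrow> complex"
  assumes f: "L2 f" and fi: "integrable lebesgue f" and fg: "is_fourier_L2 f g"
  shows "AE w in lebesgue. g w = ft (- 2 * pi) f w"
proof -
  let ?g = "\<lambda>n. fourier_trunc f (real n)"
  let ?h = "ft (- 2 * pi) f"
  let ?u = "\<lambda>n w. ennreal ((cmod (g w - ?g n w))\<^sup>2)"
  have gm [measurable]: "g \<in> borel_measurable lebesgue"
    using fg by (auto simp: L2_def is_fourier_L2_def)
  have hm [measurable]: "?g n \<in> borel_measurable lebesgue" for n
    unfolding fourier_trunc_eq_ft by (rule ft_measurable(2)[OF L2_trunc_integrable[OF f]])
  note ft_measurable(2)[OF fi, measurable]
  have lim: "(\<lambda>n. ?g n w) \<longlonglongrightarrow> ?h w" for w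
    unfolding fourier_trunc_eq_ft ft_def
  proof (rule integral_dominated_convergence)
    show "integrable lebesgue (\<lambda>x. cmod (f x))" using fi by simp
    have "(\<lambda>n. cis (- 2 * pi * (x \<bullet> w)) * (indicat_real (ball 0 (real n)) x *\<^sub>R f x)) \<longlonglongrightarrow> cis (- 2 * pi * (x \<bullet> w)) * f x" for x
      by (rule tendsto_eventually) (use indicator_ball_eventually[of x] in eventually_elim, simp)
    then show "AE x in lebesgue. (\<lambda>n. cis (- 2 * pi * (x \<bullet> w)) * (indicat_real (ball 0 (real n)) x *\<^sub>R f x)) \<longlonglongrightarrow> cis (- 2 * pi * (x \<bullet> w)) * f x"
      by simp
    show "AE x in lebesgue. norm (cis (- 2 * pi * (x \<bullet> w)) * (indicat_real (ball 0 (real n)) x *\<^sub>R f x)) \<le> cmod (f x)" for n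
      by (intro AE_I2) (auto simp: norm_mult indicator_def)
    show "(\<lambda>x. cis (- 2 * pi * (x \<bullet> w)) * f x) \<in> borel_measurable lebesgue"
      by (rule borel_measurable_integrable[OF ft_integrable[OF fi]])
    show "(\<lambda>x. cis (- 2 * pi * (x \<bullet> w)) * (indicat_real (ball 0 (real n)) x *\<^sub>R f x)) \<in> borel_measurable lebesgue" for n
      by (rule borel_measurable_integrable[OF ft_integrable[OF L2_trunc_integrable[OF f]]])
  qed
  have "(\<lambda>n. ?u n w) \<longlonglongrightarrow> ennreal ((cmod (g w - ?h w))\<^sup>2)" for w
    by (intro tendsto_ennrealI tendsto_intros lim)
  then have "(\<integral>\<^sup>+w. ennreal ((cmod (g w - ?h w))\<^sup>2) \<partial>lebesgue) = (\<integral>\<^sup>+w. liminf (\<lambda>n. ?u n w) \<partial>lebesgue)"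
    by (intro nn_integral_cong lim_imp_Liminf[symmetric]) auto
  also have "\<dots> \<le> liminf (\<lambda>n. \<integral>\<^sup>+w. ?u n w \<partial>lebesgue)"
    by (rule nn_integral_liminf) measurable
  also have "\<dots> = 0"
    by (rule lim_imp_Liminf[OF _ is_fourier_L2_sequentially[OF fg]]) simp
  finally have "(\<integral>\<^sup>+w. ennreal ((cmod (g w - ?h w))\<^sup>2) \<partial>lebesgue) = 0" by simp
  then have "AE w in lebesgue. ennreal ((cmod (g w - ?h w))\<^sup>2) = 0"
    by (subst (asm) nn_integral_0_iff_AE) measurable
  then show ?thesis by eventually_elim simp
qed

text \<open>\<open>f\<close> and the inverse Fourier integral of \<open>g\<close> have the same
  pairing with every translated Gaussian: both pairings reduce to one damped integral of
  \<open>g\<close>. Gaussians separate functions, so the two agree almost everywhere.\<close>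

lemma fourier_L2_inversion:
  fixes f g :: "'a::euclidean_space \<Rightarrow> complex"
  assumes f: "L2 f" and gi: "integrable lebesgue g" and fg: "is_fourier_L2 f g"
  shows "AE x in lebesgue. f x = ft (2 * pi) g x"
proof -
  let ?h = "ft (2 * pi) g"
  define M where "M = (LINT x|lebesgue. cmod (g x))"
  have fm [measurable]: "f \<in> borel_measurable lebesgue" using f by (simp add: L2_def)
  note hm [measurable] = ft_measurable(2)[OF gi]
  have hi: "integrable lebesgue (\<lambda>y. ?h y * of_real (gauss c (y - x)))" if "c > 0" for c x
  proof (rule Bochner_Integration.integrable_bound)
    show "integrable lebesgue (\<lambda>y. M * gauss c (y - x))"
      using gauss_integrable[OF that] by (intro integrable_mult_right)
    have "(\<lambda>y. complex_of_real (gauss c (y - x))) \<in> borel_measurable lebesgue"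
      by (rule borel_measurable_lebesgueI) measurable
    then show "(\<lambda>y. ?h y * of_real (gauss c (y - x))) \<in> borel_measurable lebesgue"
      by (intro borel_measurable_times hm)
    show "AE y in lebesgue. norm (?h y * of_real (gauss c (y - x))) \<le> norm (M * gauss c (y - x))"
      using ft_bound[OF gi, of "2 * pi"] by (intro AE_I2) (auto simp: norm_mult abs_mult M_def intro!: mult_right_mono)
  qed
  have "AE y in lebesgue. f y - ?h y = 0"
  proof (rule gauss_separating)
    fix c :: real assume c: "c > 0"
    show "integrable lebesgue (\<lambda>y. (f y - ?h y) * of_real (gauss c y))"
      using Bochner_Integration.integrable_diff[OF L2_gauss_integrable[OF f c, of 0] hi[OF c, of 0]]
      by (simp add: left_diff_distrib)
  next
    fix a :: real and x :: 'a assume a: "a > 0"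
    let ?I = "LINT w|lebesgue. of_real (gauss (1 / a) w) * cis (2 * pi * (w \<bullet> x)) * g w"
    have "?I = of_real ((1 / a) powr (- real DIM('a) / 2)) * (LINT y|lebesgue. f y * of_real (gauss a (y - x)))"
      using is_fourier_L2_gauss_pairing[OF f fg, of "1 / a" x] a by simp
    moreover have "(LINT y|lebesgue. ?h y * of_real (gauss a (y - x))) = of_real (a powr (- real DIM('a) / 2)) * ?I"
      by (rule ft_gauss_convolution[OF gi a]) (simp add: power_mult_distrib)
    \<comment> \<open>The normalising factors of the two pairing formulas are reciprocal.\<close>
    moreover have "a powr (- real DIM('a) / 2) * (1 / a) powr (- real DIM('a) / 2) = 1"
      using a by (subst powr_mult[symmetric]) auto
    then have "complex_of_real (a powr (- real DIM('a) / 2)) * of_real ((1 / a) powr (- real DIM('a) / 2)) = 1"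
      by (metis of_real_1 of_real_mult)
    ultimately have "(LINT y|lebesgue. ?h y * of_real (gauss a (y - x))) = (LINT y|lebesgue. f y * of_real (gauss a (y - x)))"
      by (simp only: mult.assoc[symmetric] mult_1_left)
    then show "(LINT y|lebesgue. (f y - ?h y) * of_real (gauss a (y - x))) = 0"
      by (simp add: left_diff_distrib Bochner_Integration.integral_diff[OF L2_gauss_integrable[OF f a] hi[OF a]])
  qed measurable
  then show ?thesis by simp
qed

text \<open>A transform that vanishes almost everywhere is integrable, so inversion applies to it.
  This injectivity makes \<open>g\<close> nonzero in the main argument.\<close>

lemma fourier_L2_zero:
  fixes f g :: "'a::euclidean_space \<Rightarrow> complex"
  assumes f: "L2 f" and fg: "is_fourier_L2 f g" and g0: "AE w in lebesgue. g w = 0"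
  shows "AE x in lebesgue. f x = 0"
proof -
  have "g \<in> borel_measurable lebesgue" using fg by (auto simp: L2_def is_fourier_L2_def)
  then have "integrable lebesgue g \<longleftrightarrow> integrable lebesgue (\<lambda>_::'a. 0 :: complex)"
    by (intro integrable_cong_AE g0) auto
  then have gi: "integrable lebesgue g" by simp
  have "ft (2 * pi) g x = 0" for x
    unfolding ft_def by (rule integral_eq_zero_AE) (use g0 in eventually_elim, simp)
  then show ?thesis using fourier_L2_inversion[OF f gi fg] by simp
qed

text \<open>Both Fourier integrals are contractions in L2, and each of \<open>f\<close>,
  \<open>g\<close> is the image of the other, so the norms agree.\<close>

lemma plancherel_L1_L2:
  fixes f g :: "'a::euclidean_space \<Rightarrow> complex"
  assumes f: "L2 f" and fi: "integrable lebesgue f" and gi: "integrable lebesgue g" and fg: "is_fourier_L2 f g"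
  shows "L2_norm f = L2_norm g"
proof -
  let ?N = "\<lambda>h::'a \<Rightarrow> complex. \<integral>\<^sup>+x. ennreal ((cmod (h x))\<^sup>2) \<partial>lebesgue"
  have g: "L2 g" using fg by (simp add: is_fourier_L2_def)
  have "?N g = ?N (ft (- 2 * pi) f)"
    using fourier_L2_eq_ft[OF f fi fg] by (intro nn_integral_cong_AE) auto
  also have "\<dots> \<le> ?N f" by (rule ft_L2_le[OF fi]) (simp add: power_mult_distrib)
  finally have "?N g \<le> ?N f" .
  have "?N f = ?N (ft (2 * pi) g)"
    using fourier_L2_inversion[OF f gi fg] by (intro nn_integral_cong_AE) auto
  also have "\<dots> \<le> ?N g" by (rule ft_L2_le[OF gi]) (simp add: power_mult_distrib)
  finally have "?N f = ?N g" using \<open>?N g \<le> ?N f\<close> by simp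
  moreover have "?N h = ennreal (LINT x|lebesgue. (cmod (h x))\<^sup>2)" if "L2 h" for h
    using that by (intro nn_integral_eq_integral) (auto simp: L2_def)
  ultimately show ?thesis using f g by (simp add: L2_norm_def)
qed

section \<open>The uncertainty inequality\<close>

text \<open>The nonstrict bound follows from the sup bound on \<open>ft s v\<close>. If strictness
  failed, the nonnegative defect \<open>D\<close> would vanish almost everywhere, which confines the
  continuous modulus of \<open>ft s v\<close> to two values.\<close>

lemma L2_norm_lt_support:
  fixes u v :: "'a::euclidean_space \<Rightarrow> complex"
  assumes u: "L2 u" and v: "integrable lebesgue v" and uv: "AE x in lebesgue. u x = ft s v x"
    and S: "emeasure lebesgue {x. u x \<noteq> 0} < \<infinity>" and nz: "\<not> (AE x in lebesgue. u x = 0)"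
  shows "(LINT x|lebesgue. (cmod (u x))\<^sup>2) < measure lebesgue {x. u x \<noteq> 0} * (LINT x|lebesgue. cmod (v x))\<^sup>2"
proof (rule ccontr)
  define M where "M = (LINT x|lebesgue. cmod (v x))"
  define E where "E = {x. u x \<noteq> 0}"
  assume "\<not> ?thesis"
  then have le: "measure lebesgue E * M\<^sup>2 \<le> (LINT x|lebesgue. (cmod (u x))\<^sup>2)"
    by (simp add: M_def E_def)
  have um [measurable]: "u \<in> borel_measurable lebesgue" and u2: "integrable lebesgue (\<lambda>x. (cmod (u x))\<^sup>2)"
    using u by (auto simp: L2_def)
  have E [measurable]: "E \<in> sets lebesgue"
  proof -
    have "{x \<in> space lebesgue. u x \<noteq> 0} \<in> sets lebesgue" by measurable
    then show ?thesis by (simp add: E_def)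
  qed
  have M: "cmod (ft s v x) \<le> M" for x using ft_bound[OF v] by (simp add: M_def)
  define D where "D x = indicator E x * M\<^sup>2 - (cmod (u x))\<^sup>2" for x
  have Ei: "integrable lebesgue (\<lambda>x. indicat_real E x * M\<^sup>2)"
    using S E by (intro integrable_mult_left) (simp add: integrable_indicator_iff E_def)
  have Di: "integrable lebesgue D"
    unfolding D_def[abs_def] by (intro Bochner_Integration.integrable_diff Ei u2)
  have D0: "AE x in lebesgue. 0 \<le> D x"
    using uv by eventually_elim (use M in \<open>auto simp: D_def E_def indicator_def intro!: power_mono\<close>)
  have "integral\<^sup>L lebesgue D = measure lebesgue E * M\<^sup>2 - (LINT x|lebesgue. (cmod (u x))\<^sup>2)"
    unfolding D_def[abs_def] by (subst Bochner_Integration.integral_diff[OF Ei u2]) simp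
  then have "integral\<^sup>L lebesgue D = 0" using le integral_nonneg_AE[OF D0] by simp
  then have "AE x in lebesgue. D x = 0"
    using integral_nonneg_eq_0_iff_AE[OF Di D0] by simp
  with uv have "AE x in lebesgue. x \<in> {x. cmod (ft s v x) \<in> {0, M}}"
  proof eventually_elim
    case (elim x)
    have "0 \<le> M" using M[of x] norm_ge_zero order_trans by blast
    show ?case
    proof (cases "u x = 0")
      case False
      then have "M\<^sup>2 = (cmod (u x))\<^sup>2" using elim by (simp add: D_def E_def)
      then show ?thesis using elim \<open>0 \<le> M\<close> by (simp add: power2_eq_iff_nonneg)
    qed (use elim in simp)
  qed
  moreover have cont: "continuous_on UNIV (\<lambda>x. cmod (ft s v x))"
    by (intro continuous_on_norm ft_continuous[OF v])
  then have "closed {x. cmod (ft s v x) \<in> {0, M}}"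
    using continuous_closed_vimage[of "{0, M}" "\<lambda>x. cmod (ft s v x)"]
    by (auto simp: vimage_def continuous_on_eq_continuous_at)
  \<comment> \<open>A closed set of full measure is the whole space.\<close>
  ultimately have vals: "cmod (ft s v x) \<in> {0, M}" for x
    using mem_closed_if_AE_lebesgue[of "{x. cmod (ft s v x) \<in> {0, M}}" x] by simp
  let ?R = "range (\<lambda>x. cmod (ft s v x))"
  have "connected ?R" using cont connected_UNIV by (rule connected_continuous_image)
  moreover have "finite ?R" by (rule finite_subset[OF image_subsetI[OF vals]]) simp
  ultimately obtain c where c: "?R = {c}" by (auto simp: connected_finite_iff_sing)
  then have const: "cmod (ft s v x) = c" for x by auto
  \<comment> \<open>A constant modulus \<open>0\<close> would make \<open>u\<close> vanish almost
    everywhere; any other constant would give \<open>E\<close> full, hence infinite,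
    measure.\<close>
  show False
  proof (cases "c = 0")
    case True
    then show False using uv nz const by simp
  next
    case False
    have "AE x in lebesgue. x \<in> E \<longleftrightarrow> x \<in> UNIV"
      using uv
    proof eventually_elim
      case (elim x)
      then show ?case using const[of x] False by (auto simp: E_def)
    qed
    then have "emeasure lebesgue E = emeasure lebesgue (UNIV :: 'a set)"
      by (intro emeasure_eq_AE) auto
    then show False using S by (simp add: E_def)
  qed
qed

text \<open>Stated for an abstract pair so that both halves of the theorem are instances. The
  Fourier relation is assumed only under finiteness conditions, since the Fourier integral of
  \<open>v\<close> requires integrability; \<open>N\<close> is the common norm, which belongs to
  \<open>u\<close> in one instance and to \<open>v\<close> in the other.\<close>

lemma support_weighted_uncertainty:
  fixes u v :: "'a::euclidean_space \<Rightarrow> complex" and N s \<alpha> :: real and c :: 'a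
  assumes u: "L2 u" and v: "L2 v"
    and u0: "\<not> (AE x in lebesgue. u x = 0)" and v0: "\<not> (AE x in lebesgue. v x = 0)"
    and \<alpha>: "\<alpha> > real DIM('a) / 2"
    and uv: "\<lbrakk>supp_measure u < \<infinity>; integrable lebesgue v\<rbrakk> \<Longrightarrow>
        (AE x in lebesgue. u x = ft s v x) \<and> L2_norm u = N \<and> L2_norm v = N"
  shows "ennreal (1 / K_const (real DIM('a)) \<alpha> * N powr (real DIM('a) / \<alpha>))
     < supp_measure u * enn_powr (weighted_L2_norm \<alpha> c v) (real DIM('a) / \<alpha>)"
proof -
  let ?d = "real DIM('a)"
  define W where "W = (\<integral>\<^sup>+ x. ennreal ((norm (x - c) powr \<alpha> * cmod (v x))\<^sup>2) \<partial>lebesgue)"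
  define th where "th = ?d / (2 * \<alpha>)"
  have a0: "\<alpha> > 0" using \<alpha> by (smt (verit) divide_nonneg_pos of_nat_0_le_iff)
  have th: "0 < th" "th < 1" using \<alpha> a0 by (auto simp: th_def)
  have K: "K_const ?d \<alpha> > 0" using \<alpha> by (intro K_const_pos) auto
  have um [measurable]: "u \<in> borel_measurable lebesgue" and u2: "integrable lebesgue (\<lambda>x. (cmod (u x))\<^sup>2)"
    using u by (auto simp: L2_def)
  have vm [measurable]: "v \<in> borel_measurable lebesgue" and v2: "integrable lebesgue (\<lambda>x. (cmod (v x))\<^sup>2)"
    using v by (auto simp: L2_def)
  have Nm [measurable]: "(\<lambda>x. norm (x - c)) \<in> borel_measurable lebesgue"
    by (rule borel_measurable_lebesgueI) measurable
  \<comment> \<open>In \<open>ennreal\<close> the product \<open>0 * \<infinity>\<close> is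
    \<open>0\<close>, so an infinite factor settles the claim only once the other factor is known to
    be nonzero. Hence \<open>S0\<close> and \<open>W0\<close>.\<close>
  have S0: "supp_measure u \<noteq> 0"
  proof
    have "{x \<in> space lebesgue. u x \<noteq> 0} \<in> sets lebesgue" by measurable
    moreover assume "supp_measure u = 0"
    ultimately have "AE x in lebesgue. u x = 0"
      by (subst AE_iff_measurable[OF _ refl]) (auto simp: supp_measure_def)
    then show False using u0 by simp
  qed
  have W0: "W \<noteq> 0"
  proof
    assume "W = 0"
    then have "AE x in lebesgue. ennreal ((norm (x - c) powr \<alpha> * cmod (v x))\<^sup>2) = 0"
      unfolding W_def by (subst (asm) nn_integral_0_iff_AE) measurable
    \<comment> \<open>The weight vanishes only at \<open>c\<close>.\<close>
    moreover have "{c} \<in> null_sets lebesgue" by (simp add: null_sets_completionI)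
    then have "AE x in lebesgue. x \<notin> {c}" by (rule AE_not_in)
    ultimately have "AE x in lebesgue. v x = 0" by eventually_elim auto
    then show False using v0 by simp
  qed
  define B where "B = enn2real W"
  have W_finite: "W = ennreal B" "B > 0"
    "enn_powr (weighted_L2_norm \<alpha> c v) (?d / \<alpha>) = ennreal (B powr th)" if "W \<noteq> \<infinity>"
  proof -
    show W: "W = ennreal B" using that by (simp add: B_def less_top)
    then show "B > 0" using W0 by (metis B_def enn2real_nonneg ennreal_0 order_le_less)
    then show "enn_powr (weighted_L2_norm \<alpha> c v) (?d / \<alpha>) = ennreal (B powr th)"
      by (simp add: weighted_L2_norm_def W_def[symmetric] W enn_powr_def powr_powr th_def)
  qed
  consider "W = \<infinity>" | "W \<noteq> \<infinity>" "supp_measure u = \<infinity>" | "W \<noteq> \<infinity>" "supp_measure u < \<infinity>"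
    using less_top[of "supp_measure u"] by fastforce
  then show ?thesis
  proof cases
    case 1
    then have "enn_powr (weighted_L2_norm \<alpha> c v) (?d / \<alpha>) = \<infinity>"
      by (simp add: weighted_L2_norm_def W_def[symmetric] enn_powr_def)
    then show ?thesis using S0 by (simp add: ennreal_mult_top)
  next
    case W: 2
    then show ?thesis using W_finite[OF W(1)] by (simp add: ennreal_top_mult)
  next
    case W: 3
    note B = W_finite(1,2)[OF W(1)] and wB = W_finite(3)[OF W(1)]
    define A where "A = (LINT x|lebesgue. (cmod (v x))\<^sup>2)"
    have A: "(\<integral>\<^sup>+x. ennreal ((cmod (v x))\<^sup>2) \<partial>lebesgue) = ennreal A"
      unfolding A_def by (rule nn_integral_eq_integral[OF v2]) simp
    have "A \<noteq> 0"
    proof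
      assume "A = 0"
      then have "AE x in lebesgue. (cmod (v x))\<^sup>2 = 0"
        unfolding A_def by (subst (asm) integral_nonneg_eq_0_iff_AE[OF v2]) auto
      then show False using v0 by simp
    qed
    moreover have "A \<ge> 0" by (simp add: A_def)
    ultimately have A0: "A > 0" by simp
    have carlson: "(\<integral>\<^sup>+x. ennreal (cmod (v x)) \<partial>lebesgue)\<^sup>2 \<le> ennreal (K_const ?d \<alpha> * A powr (1 - th) * B powr th)"
      unfolding th_def by (rule carlson_nn_integral[OF vm \<alpha> A A0 B[unfolded W_def]])
    then have "(\<integral>\<^sup>+x. ennreal (cmod (v x)) \<partial>lebesgue)\<^sup>2 < \<infinity>"
      by (rule order.strict_trans1) simp
    then have "(\<integral>\<^sup>+x. ennreal (cmod (v x)) \<partial>lebesgue) < \<infinity>"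
      by (auto simp: power2_eq_square ennreal_mult_less_top)
    \<comment> \<open>Finiteness in Carlson's inequality yields integrability of \<open>v\<close>,
      which makes the assumption \<open>uv\<close> available.\<close>
    then have vi: "integrable lebesgue v" by (intro integrableI_bounded) auto
    define M where "M = (LINT x|lebesgue. cmod (v x))"
    have "(\<integral>\<^sup>+x. ennreal (cmod (v x)) \<partial>lebesgue) = ennreal M"
      unfolding M_def using vi by (intro nn_integral_eq_integral) auto
    moreover have "M \<ge> 0" by (simp add: M_def)
    ultimately have M: "M\<^sup>2 \<le> K_const ?d \<alpha> * A powr (1 - th) * B powr th"
      using carlson K by (simp add: ennreal_power)
    note uvf = uv[OF W(2) vi]
    have NA: "N = sqrt A" using uvf by (simp add: L2_norm_def A_def)
    have "sqrt (LINT x|lebesgue. (cmod (u x))\<^sup>2) = sqrt A" using uvf NA by (simp add: L2_norm_def)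
    then have uA: "(LINT x|lebesgue. (cmod (u x))\<^sup>2) = A" by simp
    define S where "S = measure lebesgue {x. u x \<noteq> 0}"
    have S: "supp_measure u = ennreal S" 
      using W(2) unfolding S_def supp_measure_def by (intro emeasure_eq_ennreal_measure) auto
    have "A < S * M\<^sup>2"
      using L2_norm_lt_support[OF u vi conjunct1[OF uvf] _ u0] W(2)
      by (simp add: uA S_def M_def supp_measure_def)
    also have "\<dots> \<le> S * (K_const ?d \<alpha> * A powr (1 - th) * B powr th)"
      by (intro mult_left_mono M) (simp add: S_def)
    \<comment> \<open>Splitting \<open>A\<close> into powers \<open>th\<close> and
      \<open>1 - th\<close> lets the factor \<open>A powr (1 - th)\<close> from Carlson's inequality
      cancel.\<close>
    finally have "A powr th * A powr (1 - th) < (S * K_const ?d \<alpha> * B powr th) * A powr (1 - th)"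
      using A0 by (simp add: powr_add[symmetric] mult_ac)
    then have "A powr th < S * K_const ?d \<alpha> * B powr th"
      using A0 by simp
    then have "1 / K_const ?d \<alpha> * A powr th < S * B powr th"
      using K by (simp add: field_simps)
    moreover have "N powr (?d / \<alpha>) = A powr th"
      using A0 by (simp add: NA powr_half_sqrt[symmetric] powr_powr th_def)
    ultimately have "ennreal (1 / K_const ?d \<alpha> * N powr (?d / \<alpha>)) < ennreal (S * B powr th)"
      using K by (intro ennreal_lessI) (auto intro: le_less_trans[rotated])
    then show ?thesis unfolding wB S by (simp add: ennreal_mult S_def)
  qed
qed

lemma L2_finite_supp_integrable:
  fixes f :: "'a::euclidean_space \<Rightarrow> complex"
  assumes f: "L2 f" and S: "supp_measure f < \<infinity>"
  shows "integrable lebesgue f"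
proof -
  have [measurable]: "f \<in> borel_measurable lebesgue" using f by (simp add: L2_def)
  have "{x \<in> space lebesgue. f x \<noteq> 0} \<in> sets lebesgue" by measurable
  then have "integrable lebesgue (\<lambda>x. indicator {x. f x \<noteq> 0} x *\<^sub>R f x)"
    using S by (intro L2_finite_measure_integrable[OF f]) (auto simp: supp_measure_def)
  moreover have "(\<lambda>x. indicator {x. f x \<noteq> 0} x *\<^sub>R f x) = f" by (auto simp: indicator_def)
  ultimately show ?thesis by simp
qed

theorem theorem4p5:
  fixes f g :: "'a::euclidean_space \<Rightarrow> complex" and \<alpha> :: real and tbar \<omega>bar :: 'a
  assumes "L2 f"
    and "is_fourier_L2 f g"
    and "\<not> (AE x in lebesgue. f x = 0)"
    and "\<alpha> > real DIM('a) / 2"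
  shows "supp_measure f * enn_powr (weighted_L2_norm \<alpha> \<omega>bar g) (real DIM('a) / \<alpha>)
           > ennreal (1 / K_const (real DIM('a)) \<alpha> * L2_norm f powr (real DIM('a) / \<alpha>))
     \<and> supp_measure g * enn_powr (weighted_L2_norm \<alpha> tbar f) (real DIM('a) / \<alpha>)
           > ennreal (1 / K_const (real DIM('a)) \<alpha> * L2_norm f powr (real DIM('a) / \<alpha>))"
proof
  note f = assms(1) and fg = assms(2)
  have g: "L2 g" using fg by (simp add: is_fourier_L2_def)
  have g0: "\<not> (AE x in lebesgue. g x = 0)" using fourier_L2_zero[OF f fg] assms(3) by blast
  show "supp_measure f * enn_powr (weighted_L2_norm \<alpha> \<omega>bar g) (real DIM('a) / \<alpha>)
           > ennreal (1 / K_const (real DIM('a)) \<alpha> * L2_norm f powr (real DIM('a) / \<alpha>))"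
  \<comment> \<open>Here \<open>f\<close> is recovered from \<open>g\<close> by inversion, hence the
    positive sign of \<open>s\<close>; in the second half \<open>g\<close> is the forward transform
    of \<open>f\<close> and the sign is negative.\<close>
  proof (rule support_weighted_uncertainty[OF f g assms(3) g0 assms(4), where s = "2 * pi"])
    assume "supp_measure f < \<infinity>" and gi: "integrable lebesgue g"
    then have fi: "integrable lebesgue f" by (intro L2_finite_supp_integrable f)
    show "(AE x in lebesgue. f x = ft (2 * pi) g x) \<and> L2_norm f = L2_norm f \<and> L2_norm g = L2_norm f"
      using fourier_L2_inversion[OF f gi fg] plancherel_L1_L2[OF f fi gi fg] by simp
  qed
  show "supp_measure g * enn_powr (weighted_L2_norm \<alpha> tbar f) (real DIM('a) / \<alpha>)
           > ennreal (1 / K_const (real DIM('a)) \<alpha> * L2_norm f powr (real DIM('a) / \<alpha>))"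
  proof (rule support_weighted_uncertainty[OF g f g0 assms(3,4), where s = "- 2 * pi"])
    assume "supp_measure g < \<infinity>" and fi: "integrable lebesgue f"
    then have gi: "integrable lebesgue g" by (intro L2_finite_supp_integrable g)
    show "(AE x in lebesgue. g x = ft (- 2 * pi) f x) \<and> L2_norm g = L2_norm f \<and> L2_norm f = L2_norm f"
      using fourier_L2_eq_ft[OF f fi fg] plancherel_L1_L2[OF f fi gi fg] by simp
  qed
qed

end
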